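(* Let $Q$ be a Dynkin quiver of type $\mathbb A$ with vertices labelled $1,\dots,n+2$ from left to right, $F$ an alien set for $Q$, $\mathcal P=\mathcal P_{Q^F}$ the associated poset of type $\mathbb A$, and $\Bbbk$ a field. Then the function that associates to every indecomposable socle-projective representation $M=M^{\gamma(s,m)}$ of $\mathcal P$ the angle of the corresponding oriented line segment $\gamma(s,m)$ is a stability function for which every indecomposable socle-projective representation of $\mathcal P$ is stable. Explicitly: the assignment $Z([M^{\gamma(s,m)}])=\vec\gamma(s,m)\in\mathbb C$ induces a central charge $Z$ on $K_0(\operatorname{mod}_{sp}(\Bbbk\mathcal P))$, its stability function satisfies $\phi(M^{\gamma(s,m)})=\frac1\pi\theta$ with $\theta\in(-\frac\pi2,\frac\pi2)$ the angle from the positive real axis to $\vec\gamma(s,m)$, and every indecomposable object of $\operatorname{mod}_{sp}(\Bbbk\mathcal P)$ is $\phi$-stable.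
   Context: Alien sets. Let $Q$ be a quiver whose underlying graph is the path $1-2-\cdots-(n+2)$. For a sink $z$, the support of the indecomposable injective $I(z)$ is the set of vertices having a path to $z$. A finite set $F$ of new arrows between vertices of $Q$ is an alien set for $Q$ if, with $Q^F$ the quiver with vertices $Q_0$ and arrows $Q_1\cup F$: (a) for each $\alpha\in F$ there is a sink $z$ of $Q$ with $s(\alpha),t(\alpha)$ (source and target of $\alpha$) in the support of $I(z)$; (b) for each $\alpha\in F$, $t(\alpha)$ is not a source vertex of $Q$ unless it is vertex $1$ or vertex $n+2$; (c) for each $\alpha\in F$, $\alpha$ is the unique path from $s(\alpha)$ to $t(\alpha)$ in $Q^F$; (d) $Q^F$ is acyclic. The poset $\mathcal P_{Q^F}$ has underlying set $Q_0$ and $x\preceq y$ iff there is a path from $x$ to $y$ in $Q^F$. Socle-projective representations. An object of $\operatorname{mod}_{sp}(\Bbbk\mathcal P)$ is a collection $M=(M_x,{}_yh_x)$ of finite-dimensional spaces $M_x$ ($x\in\mathcal P$) and linear maps ${}_yh_x:M_x\to M_y$ for $x\preceq y$, with ${}_xh_x=\mathrm{id}$, ${}_wh_y\,{}_yh_x={}_wh_x$ for $x\preceq y\preceq w$, and $\bigcap_{x\prec z\in\max\mathcal P}\ker{}_zh_x=0$ for each non-maximal $x$. Morphisms are families of linear maps commuting with the structure maps. $K_0(\operatorname{mod}_{sp}(\Bbbk\mathcal P))\cong\mathbb Z^{\mathcal P}$ via dimension vectors. Polygon. Let $\overline{[n+1]}$ be the set of $i\in\{1,\dots,n+1\}$ with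 an arrow $i\to i+1$ in $Q$, and $\underline{[n+1]}$ the set of those with an arrow $i\leftarrow i+1$. $P(Q)$ is the convex $(n+3)$-gon in the plane with vertices $0,1,\dots,n+2$ placed in order from left to right (horizontal coordinates strictly increasing), with $0$ and $n+2$ on a horizontal line $L$, vertices of $\overline{[n+1]}$ above $L$ and vertices of $\underline{[n+1]}$ below $L$. For $0\le s<m\le n+2$, $\gamma(s,m)$ is the line segment between vertices $s$ and $m$, and $\vec\gamma(s,m)\in\mathbb C$ is the vector from point $s$ to point $m$. $R^{-1}(\ell)$ is the counterclockwise neighbour of $\ell$ on the boundary, $R^{-t}$ its iterates. Line sp-segments. A segment $\gamma(i,i+1)$ is suitable if either (a) $i\in\overline{[n+1]}\cup\{0\}$ and $i+1\in\underline{[n+1]}\cup\{n+2\}$, or (b) $i+1\in\overline{[n+1]}\cup\{0\}$ and $i\in\underline{[n+1]}\cup\{n+2\}$. The bi-fan of $\gamma(a,b)$ is $[\gamma(a,b)]_{bf}=\{\gamma(x,y): x=R^{-t}(a)\le a,\ b\le y=R^{-t'}(b)\text{ for some }t,t'\ge0\}$. Put $\overline{P(Q)}=\bigcup[\gamma(i-1,i)]_{bf}$ over suitable $\gamma(i-1,i)$ with $i\in\underline{[n+1]}\cup\{n+2\}$. Let $C=\underline{[n+1]}\cup\{n+2\}$, $D=\overline{[n+1]}\cup\{0\}$ with natural orders; $\gamma(i,j)$ ($i<j$) starts at $i$ and ends at $j$. $C'\subseteq C$ with $|C'|\ge2$ is a principal subchain of $C$ if exactly one suitable segment ends at a vertex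 of $C'$ and this vertex is $\min C'$; and at most one suitable segment starts at a vertex of $C'$, this vertex being $\max C'$ if there is one, while otherwise $\max C'=n+2$. $D'\subseteq D$ with $|D'|\ge2$ is a principal subchain of $D$ if exactly one suitable segment starts at a vertex of $D'$ and this vertex is $\max D'$; and at most one suitable segment ends at a vertex of $D'$, this vertex being $\min D'$ if there is one, while otherwise $\min D'=0$. $\underline{P(Q)}$ is the set of segments $\gamma(s,m)$ with $s\in C'\setminus\{\max C'\}$ for some principal subchain $C'$ of $C$, or $m\in D'\setminus\{\min D'\}$ for some principal subchain $D'$ of $D$. For an alien arrow $\alpha:j_2\to j_1$ with $j_1,j_2$ in the support of $I(i)$, $\gamma(s,m)$ is frozen by $\alpha$ if either $j_1<j_2$, $m\ge j_2$ and $j_1\le s<i$; or $j_1>j_2$, $s<j_2$ and $i\le m<j_1$; $[\alpha]$ is the set of such segments. $P_{\mathrm{sp}}(Q^F)=\overline{P(Q)}\setminus\big(\underline{P(Q)}\cup\bigcup_{\alpha\in F}[\alpha]\big)$ is the set of line sp-segments. For $\gamma(s,m)\in P_{\mathrm{sp}}(Q^F)$, $M^{\gamma(s,m)}$ has $M_x=\Bbbk$ for $s+1\le x\le m$, $M_x=0$ otherwise, and ${}_yh_x=1_\Bbbk$ if $x\preceq y$ and $x,y\in\{s+1,\dots,m\}$, ${}_yh_x=0$ otherwise; $\gamma(s,m)\mapsto M^{\gamma(s,m)}$ is a bijection from line sp-segments to isomorphism classes of indecomposable objects of $\operatorname{mod}_{sp}(\Bbbk\mathcal P)$. Stability. A central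 charge is a group homomorphism $Z:K_0(\operatorname{mod}_{sp}(\Bbbk\mathcal P))\to\mathbb C$ such that $Z[M]$ lies in the strict right half-plane $\{re^{i\pi\phi}: r>0,\ -\frac12<\phi<\frac12\}$ for all nonzero $M$. Its stability function is $\phi(M)=\frac1\pi\arg(Z[M])$ (principal argument). A nonzero $M$ is $\phi$-stable if every nonzero proper subrepresentation $L\subsetneq M$ satisfies $\phi(L)<\phi(M)$. *)

theory Defs
  imports "HOL-Analysis.Analysis"
begin

section \<open>Quivers of type A and alien sets\<close>

text \<open>The underlying graphs considered here are simple, so an arrow is the pair (source, target).\<close>

type_synonym arrow = "nat \<times> nat"

definition verts :: "nat \<Rightarrow> nat set" where
  "verts n = {1..n + 2}"

definition type_A_quiver :: "nat \<Rightarrow> arrow set \<Rightarrow> bool" where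
  "type_A_quiver n Q \<longleftrightarrow>
     Q \<subseteq> (\<Union>i\<in>{1..n + 1}. {(i, i + 1), (i + 1, i)}) \<and>
     (\<forall>i\<in>{1..n + 1}. (i, i + 1) \<in> Q \<longleftrightarrow> (i + 1, i) \<notin> Q)"

definition sink :: "nat \<Rightarrow> arrow set \<Rightarrow> nat \<Rightarrow> bool" where
  "sink n Q z \<longleftrightarrow> z \<in> verts n \<and> (\<forall>y. (z, y) \<notin> Q)"

definition source_vertex :: "nat \<Rightarrow> arrow set \<Rightarrow> nat \<Rightarrow> bool" where
  "source_vertex n Q z \<longleftrightarrow> z \<in> verts n \<and> (\<forall>y. (y, z) \<notin> Q)"

definition supp_inj :: "nat \<Rightarrow> arrow set \<Rightarrow> nat \<Rightarrow> nat set" where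
  "supp_inj n Q z = {x \<in> verts n. (x, z) \<in> Q\<^sup>*}"

fun quiver_path :: "arrow set \<Rightarrow> nat \<Rightarrow> arrow list \<Rightarrow> nat \<Rightarrow> bool" where
  "quiver_path E x [] y \<longleftrightarrow> x = y"
| "quiver_path E x (a # as) y \<longleftrightarrow> a \<in> E \<and> fst a = x \<and> quiver_path E (snd a) as y"

text \<open>A new arrow parallel to an arrow of Q, or two parallel new arrows, would violate the
  unique-path condition; hence F may be taken as a set of pairs disjoint from Q.\<close>

definition alien_set :: "nat \<Rightarrow> arrow set \<Rightarrow> arrow set \<Rightarrow> bool" where
  "alien_set n Q F \<longleftrightarrow>
     finite F \<and> F \<subseteq> verts n \<times> verts n \<and> F \<inter> Q = {} \<and>
     (\<forall>\<alpha>\<in>F. \<exists>z. sink n Q z \<and> fst \<alpha> \<in> supp_inj n Q z \<and> snd \<alpha> \<in> supp_inj n Q z) \<and>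
     (\<forall>\<alpha>\<in>F. source_vertex n Q (snd \<alpha>) \<longrightarrow> snd \<alpha> = 1 \<or> snd \<alpha> = n + 2) \<and>
     (\<forall>\<alpha>\<in>F. \<forall>p. quiver_path (Q \<union> F) (fst \<alpha>) p (snd \<alpha>) \<longleftrightarrow> p = [\<alpha>]) \<and>
     acyclic (Q \<union> F)"

definition alien_le :: "nat \<Rightarrow> arrow set \<Rightarrow> arrow set \<Rightarrow> nat \<Rightarrow> nat \<Rightarrow> bool" where
  "alien_le n Q F x y \<longleftrightarrow> x \<in> verts n \<and> y \<in> verts n \<and> (x, y) \<in> (Q \<union> F)\<^sup>*"


section \<open>Socle-projective representations of a finite poset\<close>

definition max_elts :: "'p set \<Rightarrow> ('p \<Rightarrow> 'p \<Rightarrow> bool) \<Rightarrow> 'p set" where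
  "max_elts P le = {z \<in> P. \<forall>y\<in>P. le z y \<longrightarrow> y = z}"

text \<open>The spaces \<open>spc M x\<close> are subspaces of an ambient vector space; \<open>str M y x\<close> is the structure
  map from \<open>spc M x\<close> to \<open>spc M y\<close>, and only its values on \<open>spc M x\<close> matter.\<close>

record ('p, 'v) poset_rep =
  spc :: "'p \<Rightarrow> 'v set"
  str :: "'p \<Rightarrow> 'p \<Rightarrow> 'v \<Rightarrow> 'v"

text \<open>The Grothendieck group is identified, via dimension vectors, with the group of integer-valued
  functions supported on \<open>P\<close>.\<close>

definition K0 :: "'p set \<Rightarrow> ('p \<Rightarrow> int) set" where
  "K0 P = {d. \<forall>x. x \<notin> P \<longrightarrow> d x = 0}"

definition K0_hom :: "'p set \<Rightarrow> (('p \<Rightarrow> int) \<Rightarrow> complex) \<Rightarrow> bool" where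
  "K0_hom P Z \<longleftrightarrow> (\<forall>d\<in>K0 P. \<forall>e\<in>K0 P. Z (\<lambda>x. d x + e x) = Z d + Z e)"

definition right_half_plane :: "complex set" where
  "right_half_plane =
     {complex_of_real r * cis (pi * \<phi>) | r \<phi>. r > 0 \<and> - 1 / 2 < \<phi> \<and> \<phi> < 1 / 2}"

definition linear_between ::
  "('k \<Rightarrow> 'v \<Rightarrow> 'v) \<Rightarrow> ('k \<Rightarrow> 'w \<Rightarrow> 'w) \<Rightarrow> 'v::ab_group_add set \<Rightarrow> 'w::ab_group_add set
    \<Rightarrow> ('v \<Rightarrow> 'w) \<Rightarrow> bool" where
  "linear_between s1 s2 U W f \<longleftrightarrow>
     f ` U \<subseteq> W \<and> (\<forall>u\<in>U. \<forall>v\<in>U. f (u + v) = f u + f v) \<and> (\<forall>c. \<forall>u\<in>U. f (s1 c u) = s2 c (f u))"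

definition rep_iso ::
  "('k \<Rightarrow> 'v \<Rightarrow> 'v) \<Rightarrow> ('k \<Rightarrow> 'w \<Rightarrow> 'w) \<Rightarrow> 'p set \<Rightarrow> ('p \<Rightarrow> 'p \<Rightarrow> bool)
    \<Rightarrow> ('p, 'v::ab_group_add) poset_rep \<Rightarrow> ('p, 'w::ab_group_add) poset_rep \<Rightarrow> bool" where
  "rep_iso s1 s2 P le M N \<longleftrightarrow>
     (\<exists>f. (\<forall>x\<in>P. linear_between s1 s2 (spc M x) (spc N x) (f x) \<and>
                 bij_betw (f x) (spc M x) (spc N x)) \<and>
          (\<forall>x\<in>P. \<forall>y\<in>P. le x y \<longrightarrow>
             (\<forall>v\<in>spc M x. f y (str M y x v) = str N y x (f x v))))"

definition sp_object ::
  "('k::field \<Rightarrow> 'v::ab_group_add \<Rightarrow> 'v) \<Rightarrow>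
   'p set \<Rightarrow> ('p \<Rightarrow> 'p \<Rightarrow> bool) \<Rightarrow> ('p, 'v) poset_rep \<Rightarrow> bool" where
  "sp_object s P le M \<longleftrightarrow>
     (\<forall>x\<in>P. module.subspace s (spc M x) \<and> (\<exists>B. finite B \<and> module.span s B = spc M x)) \<and>
     (\<forall>x\<in>P. \<forall>y\<in>P. le x y \<longrightarrow> linear_between s s (spc M x) (spc M y) (str M y x)) \<and>
     (\<forall>x\<in>P. \<forall>v\<in>spc M x. str M x x v = v) \<and>
     (\<forall>x\<in>P. \<forall>y\<in>P. \<forall>w\<in>P. le x y \<longrightarrow> le y w \<longrightarrow>
        (\<forall>v\<in>spc M x. str M w y (str M y x v) = str M w x v)) \<and>
     (\<forall>x\<in>P - max_elts P le.
        {v \<in> spc M x. \<forall>z\<in>max_elts P le. le x z \<longrightarrow> str M z x v = 0} = {0})"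

definition dimvec ::
  "('k::field \<Rightarrow> 'v::ab_group_add \<Rightarrow> 'v) \<Rightarrow>
   'p set \<Rightarrow> ('p, 'v) poset_rep \<Rightarrow> 'p \<Rightarrow> int" where
  "dimvec s P M = (\<lambda>x. if x \<in> P then int (vector_space.dim s (spc M x)) else 0)"

definition zero_rep :: "'p set \<Rightarrow> ('p, 'v::zero) poset_rep \<Rightarrow> bool" where
  "zero_rep P M \<longleftrightarrow> (\<forall>x\<in>P. spc M x = {0})"

text \<open>Subrepresentations of socle-projective representations are again socle-projective, so
  these are the subobjects in the category under consideration.\<close>

definition subrep ::
  "('k::field \<Rightarrow> 'v::ab_group_add \<Rightarrow> 'v) \<Rightarrow>
   'p set \<Rightarrow> ('p \<Rightarrow> 'p \<Rightarrow> bool) \<Rightarrow> ('p, 'v) poset_rep \<Rightarrow> ('p, 'v) poset_rep \<Rightarrow> bool" where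
  "subrep s P le L M \<longleftrightarrow>
     str L = str M \<and>
     (\<forall>x\<in>P. module.subspace s (spc L x) \<and> spc L x \<subseteq> spc M x) \<and>
     (\<forall>x\<in>P. \<forall>y\<in>P. le x y \<longrightarrow> str M y x ` spc L x \<subseteq> spc L y)"

definition indecomposable ::
  "('k::field \<Rightarrow> 'v::ab_group_add \<Rightarrow> 'v) \<Rightarrow>
   'p set \<Rightarrow> ('p \<Rightarrow> 'p \<Rightarrow> bool) \<Rightarrow> ('p, 'v) poset_rep \<Rightarrow> bool" where
  "indecomposable s P le M \<longleftrightarrow>
     sp_object s P le M \<and> \<not> zero_rep P M \<and>
     (\<forall>A B. subrep s P le A M \<longrightarrow> subrep s P le B M \<longrightarrow>
        (\<forall>x\<in>P. spc A x \<inter> spc B x = {0} \<and> {a + b | a b. a \<in> spc A x \<and> b \<in> spc B x} = spc M x) \<longrightarrow>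
        zero_rep P A \<or> zero_rep P B)"

definition central_charge ::
  "('k::field \<Rightarrow> 'v::ab_group_add \<Rightarrow> 'v) \<Rightarrow>
   'p set \<Rightarrow> ('p \<Rightarrow> 'p \<Rightarrow> bool) \<Rightarrow> (('p \<Rightarrow> int) \<Rightarrow> complex) \<Rightarrow> bool" where
  "central_charge s P le Z \<longleftrightarrow>
     K0_hom P Z \<and>
     (\<forall>M. sp_object s P le M \<longrightarrow> \<not> zero_rep P M \<longrightarrow> Z (dimvec s P M) \<in> right_half_plane)"

definition stability_fun ::
  "('k::field \<Rightarrow> 'v::ab_group_add \<Rightarrow> 'v) \<Rightarrow>
   'p set \<Rightarrow> (('p \<Rightarrow> int) \<Rightarrow> complex) \<Rightarrow> ('p, 'v) poset_rep \<Rightarrow> real" where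
  "stability_fun s P Z M = Arg (Z (dimvec s P M)) / pi"

definition phi_stable ::
  "('k::field \<Rightarrow> 'v::ab_group_add \<Rightarrow> 'v) \<Rightarrow>
   'p set \<Rightarrow> ('p \<Rightarrow> 'p \<Rightarrow> bool) \<Rightarrow> (('p \<Rightarrow> int) \<Rightarrow> complex) \<Rightarrow> ('p, 'v) poset_rep \<Rightarrow> bool" where
  "phi_stable s P le Z M \<longleftrightarrow>
     sp_object s P le M \<and> \<not> zero_rep P M \<and>
     (\<forall>L. subrep s P le L M \<longrightarrow> \<not> zero_rep P L \<longrightarrow> (\<exists>x\<in>P. spc L x \<noteq> spc M x) \<longrightarrow>
        stability_fun s P Z L < stability_fun s P Z M)"


section \<open>The polygon and its line sp-segments\<close>

definition upper :: "nat \<Rightarrow> arrow set \<Rightarrow> nat set" where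
  "upper n Q = {i \<in> {1..n + 1}. (i, i + 1) \<in> Q}"

definition lower :: "nat \<Rightarrow> arrow set \<Rightarrow> nat set" where
  "lower n Q = {i \<in> {1..n + 1}. (i + 1, i) \<in> Q}"

text \<open>The last clause says that the points are exactly the (distinct) corners of a convex polygon;
  in particular no three consecutive ones are collinear.\<close>

definition polygon :: "nat \<Rightarrow> arrow set \<Rightarrow> (nat \<Rightarrow> complex) \<Rightarrow> bool" where
  "polygon n Q p \<longleftrightarrow>
     strict_mono_on {0..n + 2} (\<lambda>i. Re (p i)) \<and>
     Im (p (n + 2)) = Im (p 0) \<and>
     (\<forall>i\<in>upper n Q. Im (p i) > Im (p 0)) \<and>
     (\<forall>i\<in>lower n Q. Im (p i) < Im (p 0)) \<and>
     (\<forall>i\<in>{0..n + 2}. p i extreme_point_of (convex hull (p ` {0..n + 2})))"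

text \<open>The segment between the vertices \<open>s < m\<close> is represented by the pair \<open>(s, m)\<close>.\<close>

definition seg_vec :: "(nat \<Rightarrow> complex) \<Rightarrow> nat \<times> nat \<Rightarrow> complex" where
  "seg_vec p g = p (snd g) - p (fst g)"

definition segments :: "nat \<Rightarrow> (nat \<times> nat) set" where
  "segments n = {(s, m). s < m \<and> m \<le> n + 2}"

text \<open>\<open>v\<close> is the counterclockwise neighbour of \<open>l\<close> on the boundary, i.e. \<open>R\<^sup>-\<^sup>1(l) = v\<close>: all the
  other vertices lie strictly to the left of the directed line from \<open>l\<close> to \<open>v\<close>.\<close>

definition ccw_next :: "nat \<Rightarrow> (nat \<Rightarrow> complex) \<Rightarrow> nat \<Rightarrow> nat \<Rightarrow> bool" where
  "ccw_next n p l v \<longleftrightarrow>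
     l \<le> n + 2 \<and> v \<le> n + 2 \<and> v \<noteq> l \<and>
     (\<forall>w\<le>n + 2. w \<noteq> l \<longrightarrow> w \<noteq> v \<longrightarrow> Im (cnj (p v - p l) * (p w - p l)) > 0)"

definition chainC :: "nat \<Rightarrow> arrow set \<Rightarrow> nat set" where
  "chainC n Q = lower n Q \<union> {n + 2}"

definition chainD :: "nat \<Rightarrow> arrow set \<Rightarrow> nat set" where
  "chainD n Q = upper n Q \<union> {0}"

text \<open>\<open>suitable n Q i\<close> says that the segment from \<open>i\<close> to \<open>i + 1\<close> is suitable.\<close>

definition suitable :: "nat \<Rightarrow> arrow set \<Rightarrow> nat \<Rightarrow> bool" where
  "suitable n Q i \<longleftrightarrow>
     (i \<in> chainD n Q \<and> i + 1 \<in> chainC n Q) \<or> (i + 1 \<in> chainD n Q \<and> i \<in> chainC n Q)"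

text \<open>The iterates of the counterclockwise neighbour map run around the whole boundary; only the
  explicit inequalities restrict them.\<close>

definition bi_fan :: "nat \<Rightarrow> (nat \<Rightarrow> complex) \<Rightarrow> nat \<Rightarrow> nat \<Rightarrow> (nat \<times> nat) set" where
  "bi_fan n p a b =
     {(x, y). (ccw_next n p)\<^sup>*\<^sup>* a x \<and> x \<le> a \<and> (ccw_next n p)\<^sup>*\<^sup>* b y \<and> b \<le> y}"

definition over_P :: "nat \<Rightarrow> arrow set \<Rightarrow> (nat \<Rightarrow> complex) \<Rightarrow> (nat \<times> nat) set" where
  "over_P n Q p = (\<Union>i\<in>{i. suitable n Q i \<and> i + 1 \<in> chainC n Q}. bi_fan n p i (i + 1))"

definition seg_starts :: "nat \<Rightarrow> arrow set \<Rightarrow> nat set" where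
  "seg_starts n Q = {i. suitable n Q i}"

definition seg_ends :: "nat \<Rightarrow> arrow set \<Rightarrow> nat set" where
  "seg_ends n Q = {i + 1 | i. suitable n Q i}"

text \<open>A suitable segment is determined by its start as well as by its end, so counting suitable
  segments that start (end) in a set of vertices amounts to counting their starts (ends).\<close>

definition principal_C :: "nat \<Rightarrow> arrow set \<Rightarrow> nat set \<Rightarrow> bool" where
  "principal_C n Q C' \<longleftrightarrow>
     C' \<subseteq> chainC n Q \<and> card C' \<ge> 2 \<and>
     C' \<inter> seg_ends n Q = {Min C'} \<and>
     (C' \<inter> seg_starts n Q = {Max C'} \<or> C' \<inter> seg_starts n Q = {} \<and> Max C' = n + 2)"

definition principal_D :: "nat \<Rightarrow> arrow set \<Rightarrow> nat set \<Rightarrow> bool" where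
  "principal_D n Q D' \<longleftrightarrow>
     D' \<subseteq> chainD n Q \<and> card D' \<ge> 2 \<and>
     D' \<inter> seg_starts n Q = {Max D'} \<and>
     (D' \<inter> seg_ends n Q = {Min D'} \<or> D' \<inter> seg_ends n Q = {} \<and> Min D' = 0)"

definition under_P :: "nat \<Rightarrow> arrow set \<Rightarrow> (nat \<times> nat) set" where
  "under_P n Q =
     {(s, m) \<in> segments n. (\<exists>C'. principal_C n Q C' \<and> s \<in> C' - {Max C'}) \<or>
                           (\<exists>D'. principal_D n Q D' \<and> m \<in> D' - {Min D'})}"

definition frozen :: "nat \<Rightarrow> arrow set \<Rightarrow> arrow \<Rightarrow> (nat \<times> nat) set" where
  "frozen n Q \<alpha> =
     (let j2 = fst \<alpha>; j1 = snd \<alpha> in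
      {(s, m) \<in> segments n.
         \<exists>i. sink n Q i \<and> j1 \<in> supp_inj n Q i \<and> j2 \<in> supp_inj n Q i \<and>
             (j1 < j2 \<and> m \<ge> j2 \<and> j1 \<le> s \<and> s < i \<or> j1 > j2 \<and> s < j2 \<and> i \<le> m \<and> m < j1)})"

definition sp_segments ::
  "nat \<Rightarrow> arrow set \<Rightarrow> arrow set \<Rightarrow> (nat \<Rightarrow> complex) \<Rightarrow> (nat \<times> nat) set" where
  "sp_segments n Q F p = over_P n Q p - (under_P n Q \<union> (\<Union>\<alpha>\<in>F. frozen n Q \<alpha>))"

definition seg_rep ::
  "(nat \<Rightarrow> nat \<Rightarrow> bool) \<Rightarrow> nat \<times> nat \<Rightarrow> (nat, 'k::field) poset_rep" where
  "seg_rep le g =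
     (let I = {fst g + 1..snd g} in
      \<lparr>spc = (\<lambda>x. if x \<in> I then UNIV else {0}),
       str = (\<lambda>y x v. if le x y \<and> x \<in> I \<and> y \<in> I then v else 0)\<rparr>)"

end

theory Submission
  imports Defs
begin

text \<open>
  On dimension vectors put \<open>Z d = (\<Sum>x. d x * (p x - p (x - 1)))\<close>, so that an interval from \<open>s + 1\<close>
  to \<open>m\<close> is sent to \<open>p m - p s\<close>; the horizontal order of the points puts every nonzero object into
  the right half-plane. Uniqueness holds because the up-sets of the poset are intervals whose
  segments are line sp-segments, and their indicators form a unitriangular basis.

  An indecomposable object is thin with interval support: an interval can be split off the
  underlying zigzag of vector spaces, and the splitting respects the alien arrows since the target
  of such an arrow embeds into the space at a single sink. A subobject of a thin interval
  representation corresponds to a subset of the interval closed under the arrows of \<open>Q\<close>. By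
  convexity the upper vertices strictly between the ends of a chord lie above it and the lower
  ones below it, so summation by parts shows that the vector of a proper subobject turns
  clockwise from the chord.
\<close>

subsection \<open>Chords of the polygon\<close>

text \<open>The orientation of \<open>Q\<close> and the shape of the polygon are matched by signs.
  An upper vertex \<open>i\<close> carries the arrow from \<open>i\<close> to \<open>i + 1\<close>,
  so a subobject of a thin interval may contain \<open>i + 1\<close> without \<open>i\<close> but
  never \<open>i\<close> without \<open>i + 1\<close>; at a lower vertex the reverse holds. After
  summation by parts the height of each vertex over the chord therefore meets a coefficient of the
  opposite sign. Alien arrows only shrink the class of subobjects, so they do not disturb this
  estimate.

  They are the obstacle in the classification: an alien arrow joins vertices that are not
  neighbours, so an object is more than a zigzag of spaces. Here the condition that the target of an
  alien arrow is no interior source is decisive. A vertex with two outgoing arrows of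
  \<open>Q\<close> is an interior source, so from such a target there is only one way to go on along
  \<open>Q\<close>, and further alien arrows keep to the same sink.\<close>

definition cross :: "(nat \<Rightarrow> complex) \<Rightarrow> nat \<Rightarrow> nat \<Rightarrow> nat \<Rightarrow> real" where
  "cross p s m y = Im (cnj (p m - p s) * (p y - p s))"

lemma cross_coords:
  "cross p s m y = (Re (p m) - Re (p s)) * (Im (p y) - Im (p s)) - (Im (p m) - Im (p s)) * (Re (p y) - Re (p s))"
  by (simp add: cross_def algebra_simps)

text \<open>The vertical line through \<open>q\<close> meets the chord \<open>a b\<close> in
  \<open>x\<close>, not below \<open>q\<close>, and the chord \<open>c d\<close> in
  \<open>y\<close>, strictly below \<open>q\<close>. So \<open>q\<close> is interior to the segment
  from \<open>y\<close> to \<open>x\<close>, or equals \<open>x\<close> and is then interior to the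
  chord \<open>a b\<close>.\<close>

lemma point_below_chord_not_extreme:
  fixes q :: complex
  assumes "convex H" "a \<in> H" "b \<in> H" "c \<in> H" "d \<in> H"
    and "Re a < Re q" "Re q < Re b" "Re c < Re q" "Re q < Re d"
    and below: "(Re b - Re a) * (Im q - Im a) \<le> (Im b - Im a) * (Re q - Re a)"
    and above: "(Re d - Re c) * (Im q - Im c) > (Im d - Im c) * (Re q - Re c)"
  shows "\<not> q extreme_point_of H"
proof
  assume ext: "q extreme_point_of H"
  define t where "t = (Re q - Re a) / (Re b - Re a)"
  define u where "u = (Re q - Re c) / (Re d - Re c)"
  define x where "x = (1 - t) *\<^sub>R a + t *\<^sub>R b"
  define y where "y = (1 - u) *\<^sub>R c + u *\<^sub>R d"
  have t: "0 < t" "t < 1" "t * (Re b - Re a) = Re q - Re a"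
    using assms(6,7) by (simp_all add: t_def)
  have u: "0 < u" "u < 1" "u * (Re d - Re c) = Re q - Re c"
    using assms(8,9) by (simp_all add: u_def)
  have xH: "x \<in> H" and yH: "y \<in> H"
    unfolding x_def y_def using assms(1-5) t u by (auto intro!: convexD_alt)
  have Rex: "Re x = Re q" and Rey: "Re y = Re q"
    using t(3) u(3) by (simp_all add: x_def y_def algebra_simps)
  have Imx: "Im q \<le> Im x"
  proof -
    have "Im q - Im a \<le> (Im b - Im a) * (Re q - Re a) / (Re b - Re a)"
      using below assms(6,7) by (simp add: pos_le_divide_eq mult.commute)
    also have "\<dots> = t * (Im b - Im a)" by (simp add: t_def)
    finally show ?thesis by (simp add: x_def algebra_simps)
  qed
  have Imy: "Im y < Im q"
  proof -
    have "Im q - Im c > (Im d - Im c) * (Re q - Re c) / (Re d - Re c)"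
      using above assms(8,9) by (simp add: pos_divide_less_eq mult.commute)
    also have "(Im d - Im c) * (Re q - Re c) / (Re d - Re c) = u * (Im d - Im c)"
      by (simp add: u_def)
    finally show ?thesis by (simp add: y_def algebra_simps)
  qed
  show False
  proof (cases "x = q")
    case True
    have "a \<noteq> b" using assms(6,7) by auto
    then have "q \<in> open_segment a b"
      unfolding in_segment using t True x_def by auto
    then show False using ext assms(2,3) by (auto simp: extreme_point_of_def)
  next
    case False
    then have lt: "Im q < Im x" using Imx Rex by (auto simp: complex_eq_iff)
    define v where "v = (Im q - Im y) / (Im x - Im y)"
    have v: "0 < v" "v < 1" "v * (Im x - Im y) = Im q - Im y"
      using lt Imy by (simp_all add: v_def)
    have "q = (1 - v) *\<^sub>R y + v *\<^sub>R x"
      using v(3) Rex Rey by (simp add: complex_eq_iff algebra_simps)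
    moreover have "y \<noteq> x" using lt Imy by auto
    ultimately have "q \<in> open_segment y x"
      unfolding in_segment using v by auto
    then show False using ext xH yH by (auto simp: extreme_point_of_def)
  qed
qed

locale type_A_polygon =
  fixes n :: nat and Q :: "arrow set" and p :: "nat \<Rightarrow> complex"
  assumes Q: "type_A_quiver n Q"
    and P: "polygon n Q p"
begin

lemma Re_less: "i < j \<Longrightarrow> j \<le> n + 2 \<Longrightarrow> Re (p i) < Re (p j)"
  using P unfolding polygon_def strict_mono_on_def by auto

lemma extreme: "i \<le> n + 2 \<Longrightarrow> p i extreme_point_of (convex hull (p ` {0..n + 2}))"
  using P unfolding polygon_def by auto

lemma point_in_hull: "i \<le> n + 2 \<Longrightarrow> p i \<in> convex hull (p ` {0..n + 2})"
  using extreme extreme_point_of_def by blast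

lemma upper_bounds: "u \<in> upper n Q \<Longrightarrow> 0 < u \<and> u < n + 2"
  and lower_bounds: "u \<in> lower n Q \<Longrightarrow> 0 < u \<and> u < n + 2"
  by (auto simp: upper_def lower_def)

lemma upper_or_lower: "0 < u \<Longrightarrow> u < n + 2 \<Longrightarrow> u \<in> upper n Q \<or> u \<in> lower n Q"
  using Q unfolding type_A_quiver_def upper_def lower_def by auto

text \<open>Otherwise \<open>p u\<close> would be on or below the chord from \<open>s\<close> to
  \<open>m\<close> while strictly above the horizontal base from \<open>0\<close> to
  \<open>n + 2\<close>, hence not a corner.\<close>

lemma upper_above_chord:
  assumes u: "u \<in> upper n Q" and "s < u" "u < m" "m \<le> n + 2"
  shows "cross p s m u > 0"
proof (rule ccontr)
  assume "\<not> ?thesis"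
  then have *: "(Re (p m) - Re (p s)) * (Im (p u) - Im (p s))
      \<le> (Im (p m) - Im (p s)) * (Re (p u) - Re (p s))"
    by (simp add: cross_coords)
  have "Im (p u) > Im (p 0)" "Im (p (n + 2)) = Im (p 0)"
    using P u unfolding polygon_def by auto
  then have **: "(Re (p (n + 2)) - Re (p 0)) * (Im (p u) - Im (p 0))
      > (Im (p (n + 2)) - Im (p 0)) * (Re (p u) - Re (p 0))"
    using Re_less[of 0 "n + 2"] by simp
  have "\<not> p u extreme_point_of (convex hull (p ` {0..n + 2}))"
    by (rule point_below_chord_not_extreme[OF convex_convex_hull _ _ _ _ _ _ _ _ * **])
      (use assms upper_bounds[OF u] in \<open>auto intro!: point_in_hull Re_less simp del: add_2_eq_Suc'\<close>)
  then show False using extreme[of u] assms by simp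
qed

end

lemma type_A_quiver_edge:
  assumes "type_A_quiver n Q" "(x, y) \<in> Q"
  shows "1 \<le> x \<and> x \<le> n + 2 \<and> 1 \<le> y \<and> y \<le> n + 2 \<and> (y = x + 1 \<or> x = y + 1)"
  using assms unfolding type_A_quiver_def by fastforce

lemma type_A_quiver_converse:
  assumes "type_A_quiver n Q"
  shows "type_A_quiver n (Q\<inverse>)"
  using assms unfolding type_A_quiver_def by fastforce

lemma upper_converse: "upper n (Q\<inverse>) = lower n Q" and lower_converse: "lower n (Q\<inverse>) = upper n Q"
  by (auto simp: upper_def lower_def)

text \<open>Reflection in the real axis exchanges upper and lower vertices, as does reversing all
  arrows; statements about lower vertices thus follow from those about upper ones.\<close>

lemma polygon_reflect:
  assumes "polygon n Q p"
  shows "polygon n (Q\<inverse>) (\<lambda>i. cnj (p i))"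
proof -
  have img: "convex hull ((\<lambda>i. cnj (p i)) ` {0..n + 2}) = cnj ` (convex hull (p ` {0..n + 2}))"
    using convex_hull_linear_image[OF bounded_linear.linear[OF bounded_linear_cnj], of "p ` {0..n + 2}"]
    by (simp add: image_image)
  have "(cnj (p i)) extreme_point_of (cnj ` (convex hull (p ` {0..n + 2})))"
    if "p i extreme_point_of (convex hull (p ` {0..n + 2}))" for i
    using that face_of_linear_image[of cnj "{p i}" "convex hull (p ` {0..n + 2})"]
    by (simp add: bounded_linear.linear[OF bounded_linear_cnj] inj_def flip: face_of_singleton)
  then show ?thesis
    using assms unfolding polygon_def upper_converse lower_converse img by simp
qed

context type_A_polygon
begin

lemma lower_below_chord:
  assumes "u \<in> lower n Q" "s < u" "u < m" "m \<le> n + 2"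
  shows "cross p s m u < 0"
proof -
  interpret reflected: type_A_polygon n "Q\<inverse>" "\<lambda>i. cnj (p i)"
    by unfold_locales (use Q P type_A_quiver_converse polygon_reflect in auto)
  have "cross (\<lambda>i. cnj (p i)) s m u > 0"
    using assms by (intro reflected.upper_above_chord) (simp_all add: upper_converse)
  then show ?thesis by (simp add: cross_coords algebra_simps)
qed

subsection \<open>The boundary walk\<close>

text \<open>Counterclockwise, the lower boundary runs from left to right. \<open>cross\<close> is
  the orientation of a triple of points, so permuting the triple puts the horizontally middle vertex
  last, where the chord lemmas give its sign.\<close>

lemma ccw_next_lower:
  assumes v: "v \<in> lower n Q \<union> {n + 2}" and l: "l \<in> lower n Q \<union> {0}" and "l < v"
    and gap: "\<And>w. l < w \<Longrightarrow> w < v \<Longrightarrow> w \<notin> lower n Q"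
  shows "ccw_next n p l v"
proof -
  have bounds: "l \<le> n + 2" "v \<le> n + 2" using v l lower_bounds by fastforce+
  have "cross p l v w > 0" if w: "w \<le> n + 2" "w \<noteq> l" "w \<noteq> v" for w
  proof -
    consider "w < l" | "l < w" "w < v" | "v < w" using w by linarith
    then show ?thesis
    proof cases
      case 1
      then have "cross p w v l < 0" using l bounds \<open>l < v\<close> by (intro lower_below_chord) auto
      then show ?thesis by (simp add: cross_coords algebra_simps)
    next
      case 2
      then have "w \<in> upper n Q" using gap upper_or_lower[of w] bounds by force
      then show ?thesis using 2 bounds by (intro upper_above_chord) auto
    next
      case 3
      then have "v \<in> lower n Q" using v w by auto
      then have "cross p l w v < 0" using 3 \<open>l < v\<close> w by (intro lower_below_chord) auto
      then show ?thesis by (simp add: cross_coords algebra_simps)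
    qed
  qed
  then show ?thesis
    using bounds \<open>l < v\<close> unfolding ccw_next_def cross_def by auto
qed

lemma ccw_next_upper:
  assumes v: "v \<in> upper n Q \<union> {0}" and l: "l \<in> upper n Q \<union> {n + 2}" and "v < l"
    and gap: "\<And>w. v < w \<Longrightarrow> w < l \<Longrightarrow> w \<notin> upper n Q"
  shows "ccw_next n p l v"
proof -
  have bounds: "l \<le> n + 2" "v \<le> n + 2" using v l upper_bounds by fastforce+
  have "cross p l v w > 0" if w: "w \<le> n + 2" "w \<noteq> l" "w \<noteq> v" for w
  proof -
    consider "w < v" | "v < w" "w < l" | "l < w" using w by linarith
    then show ?thesis
    proof cases
      case 1
      then have "cross p w l v > 0" using v bounds \<open>v < l\<close> by (intro upper_above_chord) auto
      then show ?thesis by (simp add: cross_coords algebra_simps)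
    next
      case 2
      then have "w \<in> lower n Q" using gap upper_or_lower[of w] bounds by force
      then have "cross p v l w < 0" using 2 bounds by (intro lower_below_chord) auto
      then show ?thesis by (simp add: cross_coords algebra_simps)
    next
      case 3
      then have "l \<in> upper n Q" using l w by auto
      then have "cross p v w l > 0" using 3 \<open>v < l\<close> w by (intro upper_above_chord) auto
      then show ?thesis by (simp add: cross_coords algebra_simps)
    qed
  qed
  then show ?thesis
    using bounds \<open>v < l\<close> unfolding ccw_next_def cross_def by auto
qed

lemma ccw_reach_lower:
  assumes "v \<in> lower n Q \<union> {n + 2}" "l \<in> lower n Q \<union> {0}" "l < v"
  shows "(ccw_next n p)\<^sup>*\<^sup>* l v"
  using assms
proof (induction "v - l" arbitrary: l rule: less_induct)
  case less
  show ?case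
  proof (cases "\<exists>w. l < w \<and> w < v \<and> w \<in> lower n Q")
    \<comment> \<open>The walk stops first at the nearest lower vertex to the right of
      \<open>l\<close>, since a single boundary step requires that no lower vertex is
      skipped.\<close>
    case True
    define w where "w = (LEAST w. l < w \<and> w < v \<and> w \<in> lower n Q)"
    have w: "l < w" "w < v" "w \<in> lower n Q"
      using LeastI_ex[OF True] unfolding w_def by auto
    have "u \<notin> lower n Q" if "l < u" "u < w" for u
      using not_less_Least[of u "\<lambda>w. l < w \<and> w < v \<and> w \<in> lower n Q"] that w(2) unfolding w_def by auto
    then have "ccw_next n p l w" using w less.prems by (intro ccw_next_lower) auto
    moreover have "(ccw_next n p)\<^sup>*\<^sup>* w v" using w less.prems by (intro less.hyps) auto
    ultimately show ?thesis by (rule converse_rtranclp_into_rtranclp)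
  next
    case False
    then show ?thesis using less.prems by (intro r_into_rtranclp ccw_next_lower) auto
  qed
qed

lemma ccw_reach_upper:
  assumes "v \<in> upper n Q \<union> {0}" "l \<in> upper n Q \<union> {n + 2}" "v < l"
  shows "(ccw_next n p)\<^sup>*\<^sup>* l v"
  using assms
proof (induction "l - v" arbitrary: v rule: less_induct)
  case less
  show ?case
  proof (cases "\<exists>w. v < w \<and> w < l \<and> w \<in> upper n Q")
    case True
    define w where "w = (LEAST w. v < w \<and> w < l \<and> w \<in> upper n Q)"
    have w: "v < w" "w < l" "w \<in> upper n Q"
      using LeastI_ex[OF True] unfolding w_def by auto
    have "u \<notin> upper n Q" if "v < u" "u < w" for u
      using not_less_Least[of u "\<lambda>w. v < w \<and> w < l \<and> w \<in> upper n Q"] that w(2) unfolding w_def by auto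
    then have "ccw_next n p w v" using w less.prems by (intro ccw_next_upper) auto
    moreover have "(ccw_next n p)\<^sup>*\<^sup>* l w" using w less.prems by (intro less.hyps) auto
    ultimately show ?thesis by (rule rtranclp.rtrancl_into_rtrancl[rotated])
  next
    case False
    then show ?thesis using less.prems by (intro r_into_rtranclp ccw_next_upper) auto
  qed
qed

text \<open>The lower chain leads from \<open>0\<close> to \<open>n + 2\<close> and the upper chain
  back again, so the boundary is one cycle and any vertex is reached by way of
  \<open>0\<close>.\<close>

lemma ccw_reach:
  assumes "a \<le> n + 2" "b \<le> n + 2"
  shows "(ccw_next n p)\<^sup>*\<^sup>* a b"
proof -
  have top: "(ccw_next n p)\<^sup>*\<^sup>* (n + 2) 0" and bot: "(ccw_next n p)\<^sup>*\<^sup>* 0 (n + 2)"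
    by (rule ccw_reach_upper; simp) (rule ccw_reach_lower; simp)
  have "(ccw_next n p)\<^sup>*\<^sup>* a 0"
  proof -
    consider "a = 0" | "a \<in> upper n Q \<union> {n + 2}" "0 < a" | "a \<in> lower n Q" "a < n + 2"
      using upper_or_lower[of a] assms by (cases "a = 0"; cases "a = n + 2") auto
    then show ?thesis
    proof cases
      case 2
      then show ?thesis by (intro ccw_reach_upper) auto
    next
      case 3
      then have "(ccw_next n p)\<^sup>*\<^sup>* a (n + 2)" by (intro ccw_reach_lower) auto
      then show ?thesis using top by (rule rtranclp_trans)
    qed auto
  qed
  moreover have "(ccw_next n p)\<^sup>*\<^sup>* 0 b"
  proof -
    consider "b = 0" | "b \<in> lower n Q \<union> {n + 2}" "0 < b" | "b \<in> upper n Q" "b < n + 2"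
      using upper_or_lower[of b] assms by (cases "b = 0"; cases "b = n + 2") auto
    then show ?thesis
    proof cases
      case 2
      then show ?thesis by (intro ccw_reach_lower) auto
    next
      case 3
      then have "(ccw_next n p)\<^sup>*\<^sup>* (n + 2) b" by (intro ccw_reach_upper) auto
      with bot show ?thesis by (rule rtranclp_trans)
    qed auto
  qed
  ultimately show ?thesis by (rule rtranclp_trans)
qed

lemma ccw_next_le: "(ccw_next n p)\<^sup>*\<^sup>* a b \<Longrightarrow> a \<le> n + 2 \<Longrightarrow> b \<le> n + 2"
  by (induction rule: rtranclp_induct) (auto simp: ccw_next_def)

text \<open>Since iterating the neighbour map reaches every vertex, only the two inequalities
  restrict a bi-fan, and the geometry drops out.\<close>

lemma bi_fan_eq:
  assumes "a \<le> n + 2" "b \<le> n + 2"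
  shows "bi_fan n p a b = {(x, y). x \<le> a \<and> b \<le> y \<and> y \<le> n + 2}"
proof -
  have "b' \<le> n + 2" if "(ccw_next n p)\<^sup>*\<^sup>* b b'" for b'
    using ccw_next_le[OF that] assms by simp
  moreover have "(ccw_next n p)\<^sup>*\<^sup>* a x" if "x \<le> a" for x
    using ccw_reach[of a x] assms that by simp
  moreover have "(ccw_next n p)\<^sup>*\<^sup>* b y" if "y \<le> n + 2" for y
    using ccw_reach[of b y] assms that by simp
  ultimately show ?thesis unfolding bi_fan_def by blast
qed

end

subsection \<open>Paths in the extended quiver\<close>

text \<open>Each arrow of \<open>Q\<close> changes the label by one, so a path cannot skip a label
  between its ends.\<close>

lemma type_A_quiver_path_between:
  assumes "type_A_quiver n Q" "(x, y) \<in> Q\<^sup>*" "min x y \<le> w" "w \<le> max x y"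
  shows "(x, w) \<in> Q\<^sup>* \<and> (w, y) \<in> Q\<^sup>*"
  using assms(2-)
proof (induction arbitrary: w rule: rtrancl_induct)
  case base
  then show ?case by simp
next
  case (step y z)
  from type_A_quiver_edge[OF assms(1) step.hyps(2)] have "z = y + 1 \<or> y = z + 1" by simp
  then consider "w = z" | "min x y \<le> w \<and> w \<le> max x y"
    using step.prems by linarith
  then show ?case
  proof cases
    case 1
    then show ?thesis using step.hyps by auto
  next
    case 2
    then show ?thesis using step.IH[of w] step.hyps(2) by (auto intro: rtrancl_into_rtrancl)
  qed
qed

locale alien_polygon = type_A_polygon +
  fixes F :: "arrow set"
  assumes F: "alien_set n Q F"
begin

lemma edge: "(x, y) \<in> Q \<Longrightarrow> 1 \<le> x \<and> x \<le> n + 2 \<and> 1 \<le> y \<and> y \<le> n + 2 \<and> (y = x + 1 \<or> x = y + 1)"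
  using type_A_quiver_edge[OF Q] .

lemma edge_orient: "(x, y) \<in> Q \<Longrightarrow> (y, x) \<notin> Q"
  using edge[of x y] Q unfolding type_A_quiver_def by auto

lemma edge_exists: "1 \<le> x \<Longrightarrow> x < n + 2 \<Longrightarrow> (x, x + 1) \<in> Q \<or> (x + 1, x) \<in> Q"
  using Q unfolding type_A_quiver_def by auto

lemma alien_arrowE:
  assumes "(x, y) \<in> F"
  obtains i where "sink n Q i" "x \<in> supp_inj n Q i" "y \<in> supp_inj n Q i"
  using F assms unfolding alien_set_def by force

lemma acyclic: "acyclic (Q \<union> F)"
  using F unfolding alien_set_def by simp

lemma reach_antisym: "(x, y) \<in> (Q \<union> F)\<^sup>* \<Longrightarrow> (y, x) \<in> (Q \<union> F)\<^sup>* \<Longrightarrow> x = y"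
  using acyclic_impl_antisym_rtrancl[OF acyclic] by (auto simp: antisym_def)

lemma reach_Q: "(x, y) \<in> Q\<^sup>* \<Longrightarrow> (x, y) \<in> (Q \<union> F)\<^sup>*"
  using rtrancl_mono[of Q "Q \<union> F"] by blast

lemma arrow_verts: "(x, y) \<in> Q \<union> F \<Longrightarrow> x \<in> verts n \<and> y \<in> verts n"
  using edge[of x y] F by (auto simp: verts_def alien_set_def)

lemma reach_verts: "(x, y) \<in> (Q \<union> F)\<^sup>* \<Longrightarrow> x \<in> verts n \<Longrightarrow> y \<in> verts n"
  by (induction rule: rtrancl_induct) (use arrow_verts in auto)

lemma wf_arrows: "wf ((Q \<union> F)\<inverse>)"
proof -
  have "Q \<union> F \<subseteq> verts n \<times> verts n" using arrow_verts by auto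
  then have "finite (Q \<union> F)" by (rule finite_subset) (simp add: verts_def)
  then show ?thesis using acyclic by (rule finite_acyclic_wf_converse)
qed

text \<open>This makes up-sets intervals. An alien arrow from \<open>y\<close> to \<open>z\<close>
  may jump over \<open>w\<close>, but both ends flow along \<open>Q\<close> to a common sink, and
  the two flows together pass through every vertex between \<open>y\<close> and
  \<open>z\<close>.\<close>

lemma reach_between:
  assumes "(x, y) \<in> (Q \<union> F)\<^sup>*" "min x y \<le> w" "w \<le> max x y"
  shows "(x, w) \<in> (Q \<union> F)\<^sup>*"
  using assms
proof (induction arbitrary: w rule: rtrancl_induct)
  case base
  then show ?case by simp
next
  case (step y z)
  show ?case
  proof (cases "min x y \<le> w \<and> w \<le> max x y")
    case True
    then show ?thesis using step.IH by simp
  next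
    case False
    then have w: "min y z \<le> w" "w \<le> max y z" using step.prems by linarith+
    have xz: "(x, z) \<in> (Q \<union> F)\<^sup>*" using step.hyps by (rule rtrancl_into_rtrancl)
    show ?thesis
    proof (cases "(y, z) \<in> Q")
      case True
      then have "w = y \<or> w = z" using w edge[of y z] by linarith
      then show ?thesis using step.hyps(1) xz by blast
    next
      case False
      then obtain i where i: "(y, i) \<in> Q\<^sup>*" "(z, i) \<in> Q\<^sup>*"
        using step.hyps(2) by (auto elim!: alien_arrowE simp: supp_inj_def)
      have "(min y i \<le> w \<and> w \<le> max y i) \<or> (min z i \<le> w \<and> w \<le> max z i)"
        using w by linarith
      then have "(y, w) \<in> Q\<^sup>* \<or> (z, w) \<in> Q\<^sup>*"
        using type_A_quiver_path_between[OF Q] i by blast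
      then show ?thesis using rtrancl_trans[OF step.hyps(1) reach_Q] rtrancl_trans[OF xz reach_Q] by blast
    qed
  qed
qed

text \<open>Following arrows as long as possible ends by well-foundedness at a vertex with no
  outgoing arrow at all, in particular none of \<open>Q\<close>.\<close>

lemma reach_sink:
  assumes "x \<in> verts n"
  obtains z where "(x, z) \<in> (Q \<union> F)\<^sup>*" "sink n Q z"
proof -
  obtain z where z: "(x, z) \<in> (Q \<union> F)\<^sup>*" "\<And>y. (z, y) \<in> Q \<union> F \<Longrightarrow> (x, y) \<notin> (Q \<union> F)\<^sup>*"
    using wfE_min[OF wf_arrows, of x "{y. (x, y) \<in> (Q \<union> F)\<^sup>*}"] by auto
  then have "(z, y) \<notin> Q" for y by (auto intro: rtrancl_into_rtrancl)
  with z(1) assms that show ?thesis unfolding sink_def using reach_verts by blast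
qed

section \<open>Line sp-segments of up-sets\<close>

text \<open>All arrows at a sink point into it, so \<open>i - 1\<close> is upper or \<open>0\<close>
  and \<open>i\<close> is lower or \<open>n + 2\<close>: the segment from \<open>i - 1\<close> to
  \<open>i\<close> is suitable, and its bi-fan consists of the segments that pass over it.\<close>

lemma sink_in_over_P:
  assumes i: "sink n Q i" and "s < i" "i \<le> m" "m \<le> n + 2"
  shows "(s, m) \<in> over_P n Q p"
proof -
  have "i - 1 \<in> chainD n Q"
  proof (cases "i = 1")
    case False
    then have "(i - 1, i) \<in> Q" using edge_exists[of "i - 1"] assms by (auto simp: sink_def)
    then show ?thesis using False assms by (auto simp: chainD_def upper_def)
  qed (simp add: chainD_def)
  moreover have "i \<in> chainC n Q"
  proof (cases "i = n + 2")
    case False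
    then have "(i + 1, i) \<in> Q" using edge_exists[of "i"] assms by (auto simp: sink_def)
    then show ?thesis using False assms by (auto simp: chainC_def lower_def)
  qed (simp add: chainC_def)
  ultimately have "bi_fan n p (i - 1) i \<subseteq> over_P n Q p"
    using assms unfolding over_P_def by (force simp: suitable_def)
  then show ?thesis using bi_fan_eq[of "i - 1" i] assms by auto
qed

text \<open>Either alternative gives an arrow of \<open>Q\<close> leaving \<open>{s + 1..m}\<close>
  at one of its ends. The excluded extremal vertex of the subchain guarantees that \<open>s\<close>
  is not \<open>n + 2\<close>, respectively that \<open>m\<close> is not \<open>0\<close>.\<close>

lemma under_P_not_closed:
  assumes "(s, m) \<in> under_P n Q"
  shows "(s \<in> lower n Q) \<or> (m \<in> upper n Q)"
proof -
  from assms consider C' where "principal_C n Q C'" "s \<in> C' - {Max C'}"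
    | D' where "principal_D n Q D'" "m \<in> D' - {Min D'}"
    unfolding under_P_def by auto
  then show ?thesis
  proof cases
    case 1
    \<comment> \<open>An infinite set has \<open>card\<close> 0, so the bound
      \<open>card C' \<ge> 2\<close> already forces finiteness.\<close>
    have "finite C'" using 1 card.infinite[of C'] by (force simp: principal_C_def)
    then have "s < Max C'" using 1 Max_ge[of C' s] by (simp add: order_le_neq_trans)
    moreover have "Max C' \<le> n + 2"
    proof -
      have "Max C' \<in> chainC n Q"
        using 1 \<open>finite C'\<close> Max_in[of C'] unfolding principal_C_def by blast
      then show ?thesis using lower_bounds[of "Max C'"] unfolding chainC_def by auto
    qed
    ultimately show ?thesis using 1 by (auto simp: principal_C_def chainC_def)
  next
    case 2
    have "finite D'" using 2 card.infinite[of D'] by (force simp: principal_D_def)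
    then have "Min D' < m" using 2 Min_le[of D' m] by (simp add: order_le_neq_trans)
    then show ?thesis using 2 by (auto simp: principal_D_def chainD_def)
  qed
qed

text \<open>The inequalities of a frozen segment put the target \<open>j1\<close> outside the
  interval and the source \<open>j2\<close> inside, unless \<open>j2\<close> lies between
  \<open>j1\<close> and the sink. In that exceptional case the path from \<open>j1\<close> to the
  sink meets \<open>j2\<close> and closes a cycle with the alien arrow.\<close>

lemma closed_interval_not_frozen:
  assumes U: "\<And>x y. x \<in> {l..r} \<Longrightarrow> (x, y) \<in> Q \<union> F \<Longrightarrow> y \<in> {l..r}"
    and l: "1 \<le> l" and \<alpha>F: "\<alpha> \<in> F"
  shows "(l - 1, r) \<notin> frozen n Q \<alpha>"
proof
  assume frozen: "(l - 1, r) \<in> frozen n Q \<alpha>"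
  obtain j2 j1 where \<alpha>: "\<alpha> = (j2, j1)" by fastforce
  from frozen obtain i where i: "(j1, i) \<in> Q\<^sup>*" "(j2, i) \<in> Q\<^sup>*"
    and cs: "j1 < j2 \<and> r \<ge> j2 \<and> j1 \<le> l - 1 \<and> l - 1 < i \<or> j1 > j2 \<and> l - 1 < j2 \<and> i \<le> r \<and> r < j1"
    unfolding frozen_def supp_inj_def \<alpha> by auto
  have "(j1, j2) \<notin> Q\<^sup>*"
  proof
    assume "(j1, j2) \<in> Q\<^sup>*"
    then have "j1 = j2" using reach_antisym[of j1 j2] reach_Q \<alpha> \<alpha>F by blast
    then show False using cs by auto
  qed
  then have nb: "\<not> (min j1 i \<le> j2 \<and> j2 \<le> max j1 i)"
    using type_A_quiver_path_between[OF Q i(1)] by blast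
  have "j2 \<in> {l..r}" "j1 \<notin> {l..r}" using cs nb l by auto
  then show False using U[of j2 j1] \<alpha> \<alpha>F by blast
qed

text \<open>These are the segments of the indecomposable projective objects.\<close>

lemma upset_segment:
  assumes x: "x \<in> verts n"
  obtains l r where "{y. (x, y) \<in> (Q \<union> F)\<^sup>*} = {l..r}" "1 \<le> l" "l \<le> r" "r \<le> n + 2"
    "(l - 1, r) \<in> sp_segments n Q F p"
proof -
  define U where "U = {y. (x, y) \<in> (Q \<union> F)\<^sup>*}"
  have sub: "U \<subseteq> verts n" unfolding U_def using reach_verts x by auto
  then have fin: "finite U" by (rule finite_subset) (simp add: verts_def)
  have xU: "x \<in> U" unfolding U_def by simp
  define l where "l = Min U"
  define r where "r = Max U"
  have lr: "l \<in> U" "r \<in> U" "U \<subseteq> {l..r}" "l \<le> x" "x \<le> r"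
    unfolding l_def r_def using fin xU by (auto intro: Min_in Max_in)
  have Ueq: "U = {l..r}"
  proof
    show "{l..r} \<subseteq> U"
    proof
      fix w assume w: "w \<in> {l..r}"
      \<comment> \<open>Any \<open>w\<close> of the interval lies between \<open>x\<close> and one
        of the two extreme reachable vertices.\<close>
      have "(min x l \<le> w \<and> w \<le> max x l) \<or> (min x r \<le> w \<and> w \<le> max x r)"
        using w lr by auto
      then show "w \<in> U" using reach_between lr(1,2) unfolding U_def by blast
    qed
  qed (rule lr)
  have bounds: "1 \<le> l" "r \<le> n + 2" using lr(1,2) sub by (auto simp: verts_def)
  have closed: "b \<in> {l..r}" if "a \<in> {l..r}" "(a, b) \<in> Q \<union> F" for a b
    using that unfolding Ueq[symmetric] U_def by (auto intro: rtrancl_into_rtrancl)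
  obtain z where z: "z \<in> U" "sink n Q z" using reach_sink[OF x] unfolding U_def by auto
  have "(l - 1, r) \<in> over_P n Q p"
    using z Ueq bounds by (intro sink_in_over_P[of z]) auto
  moreover have "(l - 1, r) \<notin> under_P n Q"
  proof
    assume "(l - 1, r) \<in> under_P n Q"
    \<comment> \<open>A segment in \<open>under_P\<close> would provide an arrow leaving the up-set
      at its left or right end.\<close>
    then have "(l, l - 1) \<in> Q \<or> (r, r + 1) \<in> Q"
      using under_P_not_closed bounds unfolding lower_def upper_def by fastforce
    then show False using closed[of l "l - 1"] closed[of r "r + 1"] lr bounds by auto
  qed
  moreover have "(l - 1, r) \<notin> frozen n Q \<alpha>" if "\<alpha> \<in> F" for \<alpha>
    using closed_interval_not_frozen[OF closed bounds(1) that] .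
  ultimately have "(l - 1, r) \<in> sp_segments n Q F p" unfolding sp_segments_def by auto
  moreover have "l \<le> r" using lr by simp
  ultimately show ?thesis using that Ueq bounds unfolding U_def by blast
qed

lemma sp_segment_bounds:
  assumes "(s, m) \<in> sp_segments n Q F p"
  shows "s < m \<and> m \<le> n + 2"
proof -
  from assms have "(s, m) \<in> over_P n Q p" by (simp add: sp_segments_def)
  then obtain i where i: "i + 1 \<in> chainC n Q" "(s, m) \<in> bi_fan n p i (i + 1)"
    unfolding over_P_def by blast
  then have "i + 1 \<le> n + 2" using lower_bounds[of "i + 1"] by (auto simp: chainC_def)
  then have "bi_fan n p i (i + 1) = {(x, y). x \<le> i \<and> i + 1 \<le> y \<and> y \<le> n + 2}"
    by (intro bi_fan_eq) simp_all
  then show ?thesis using i(2) by simp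
qed

section \<open>Sinks below the target of an alien arrow\<close>

text \<open>On a line, two different outgoing arrows use up both neighbours, so no arrow enters and
  \<open>w\<close> is an interior source.\<close>

lemma out_arrow_unique:
  assumes "(w, a) \<in> Q" "(w, b) \<in> Q" "source_vertex n Q w \<Longrightarrow> w = 1 \<or> w = n + 2"
  shows "a = b"
proof (rule ccontr)
  assume "a \<noteq> b"
  then have ab: "{a, b} = {w - 1, w + 1}" "1 < w" "w < n + 2"
    using edge[OF assms(1)] edge[OF assms(2)] by auto
  have "source_vertex n Q w"
    unfolding source_vertex_def
  proof (intro conjI allI)
    show "(y, w) \<notin> Q" for y
    proof
      assume "(y, w) \<in> Q"
      moreover from this have "y \<in> {a, b}" using edge[of y w] unfolding ab(1) by auto
      ultimately show False using assms edge_orient by blast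
    qed
  qed (use ab in \<open>simp add: verts_def\<close>)
  then show False using assms(3) ab by auto
qed

text \<open>The set \<open>S\<close> of vertices that flow to \<open>i\<close> and are not interior
  sources is invariant under all arrows: an arrow of \<open>Q\<close> leaving \<open>S\<close>
  follows the only way to \<open>i\<close>, and an alien arrow shares a sink with its
  source.\<close>

lemma alien_target_unique_sink:
  assumes xy: "(x, y) \<in> F" and i: "sink n Q i" "y \<in> supp_inj n Q i"
    and z: "(y, z) \<in> (Q \<union> F)\<^sup>*"
  shows "z \<in> supp_inj n Q i"
proof -
  define S where "S = {w \<in> supp_inj n Q i. source_vertex n Q w \<longrightarrow> w = 1 \<or> w = n + 2}"
  have step_Q: "w' \<in> S" if "w \<in> S" "(w, w') \<in> Q" for w w'
  proof -
    have "w \<noteq> i" using that(2) i(1) by (auto simp: sink_def)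
    moreover have "(w, i) \<in> Q\<^sup>*" using that(1) by (simp add: S_def supp_inj_def)
    ultimately obtain w'' where w'': "(w, w'') \<in> Q" "(w'', i) \<in> Q\<^sup>*"
      by (metis converse_rtranclE)
    have "w' = w''" using out_arrow_unique[OF that(2) w''(1)] that(1) by (simp add: S_def)
    then show ?thesis
      using w''(2) that(2) arrow_verts by (auto simp: S_def supp_inj_def source_vertex_def)
  qed
  have step_F: "w' \<in> S" if w: "w \<in> S" "(w, w') \<in> F" for w w'
  proof -
    obtain k where k: "sink n Q k" "w \<in> supp_inj n Q k" "w' \<in> supp_inj n Q k"
      using alien_arrowE[OF w(2)] .
    have "(w, k) \<in> Q\<^sup>*" using k(2) by (simp add: supp_inj_def)
    \<comment> \<open>The path from \<open>w\<close> to \<open>k\<close> runs in \<open>Q\<close>,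
      under which \<open>S\<close> is already known to be invariant; a sink that flows to
      \<open>i\<close> must be \<open>i\<close>.\<close>
    then have "k \<in> S" by (induction rule: rtrancl_induct) (use w(1) step_Q in auto)
    then have "(k, i) \<in> Q\<^sup>*" by (simp add: S_def supp_inj_def)
    then have "k = i" using k(1) by (metis converse_rtranclE sink_def)
    moreover have "source_vertex n Q w' \<longrightarrow> w' = 1 \<or> w' = n + 2"
      using F w(2) unfolding alien_set_def by fastforce
    ultimately show ?thesis using k by (simp add: S_def)
  qed
  have "source_vertex n Q y \<longrightarrow> y = 1 \<or> y = n + 2"
    using F xy unfolding alien_set_def by fastforce
  then have "y \<in> S" using i by (simp add: S_def)
  with z have "z \<in> S"
  proof (induction rule: rtrancl_induct)
    case (step w w')
    then show ?case using step_Q step_F by blast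
  qed
  then show ?thesis by (simp add: S_def)
qed

end

subsection \<open>Homomorphisms on the Grothendieck group\<close>

lemma K0_hom_add:
  "K0_hom P D \<Longrightarrow> d \<in> K0 P \<Longrightarrow> e \<in> K0 P \<Longrightarrow> D (\<lambda>x. d x + e x) = D d + D e"
  by (simp add: K0_hom_def)

lemma K0_hom_zero:
  assumes "K0_hom P D" shows "D (\<lambda>x. 0) = 0"
  using K0_hom_add[OF assms, of "\<lambda>x. 0" "\<lambda>x. 0"] by (simp add: K0_def)

lemma K0_hom_sum:
  assumes D: "K0_hom P D" and "finite I" "\<And>i. i \<in> I \<Longrightarrow> f i \<in> K0 P"
  shows "D (\<lambda>x. \<Sum>i\<in>I. f i x) = (\<Sum>i\<in>I. D (f i))"
  using assms(2,3)
proof (induction I rule: finite_induct)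
  case empty
  then show ?case using K0_hom_zero[OF D] by simp
next
  case (insert i I)
  have "f i \<in> K0 P" "(\<lambda>x. \<Sum>i\<in>I. f i x) \<in> K0 P"
    using insert.prems by (auto simp: K0_def intro!: sum.neutral)
  then show ?case using insert K0_hom_add[OF D] by simp
qed

lemma K0_hom_scale:
  assumes D: "K0_hom P D" and d: "d \<in> K0 P"
  shows "D (\<lambda>x. k * d x) = of_int k * D d"
proof -
  have nat: "D (\<lambda>x. int j * d x) = of_nat j * D d" for j
  proof (induction j)
    case 0
    then show ?case using K0_hom_zero[OF D] by simp
  next
    case (Suc j)
    have "(\<lambda>x. int j * d x) \<in> K0 P" using d by (auto simp: K0_def)
    then have "D (\<lambda>x. d x + int j * d x) = D d + D (\<lambda>x. int j * d x)"
      by (rule K0_hom_add[OF D d])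
    then show ?case using Suc by (simp add: algebra_simps)
  qed
  show ?thesis
  proof (cases "k \<ge> 0")
    case True
    then show ?thesis using nat[of "nat k"] by simp
  next
    case False
    define j where "j = nat (- k)"
    have k: "k = - int j" using False by (simp add: j_def)
    have "(\<lambda>x. int j * d x) \<in> K0 P" "(\<lambda>x. k * d x) \<in> K0 P" using d by (auto simp: K0_def)
    then have "D (\<lambda>x. int j * d x + k * d x) = D (\<lambda>x. int j * d x) + D (\<lambda>x. k * d x)"
      by (rule K0_hom_add[OF D])
    moreover have "(\<lambda>x. int j * d x + k * d x) = (\<lambda>x. 0)" unfolding k by simp
    ultimately have "of_nat j * D d + D (\<lambda>x. k * d x) = 0"
      using nat[of j] K0_hom_zero[OF D] by simp
    then show ?thesis unfolding k by (simp add: add_eq_0_iff)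
  qed
qed

text \<open>Indicators of up-sets form a basis, being unitriangular with respect to the order.\<close>

lemma K0_hom_vanishes:
  fixes r :: "('p \<times> 'p) set"
  assumes D: "K0_hom P D" and fin: "finite P" and wf: "wf (r\<inverse>)"
    and closed: "\<And>x y. x \<in> P \<Longrightarrow> (x, y) \<in> r\<^sup>* \<Longrightarrow> y \<in> P"
    and up: "\<And>x. x \<in> P \<Longrightarrow> D (\<lambda>y. if (x, y) \<in> r\<^sup>* then 1 else 0) = 0"
    and d: "d \<in> K0 P"
  shows "D d = 0"
proof -
  let ?e = "\<lambda>x y. if y = x then 1 else (0::int)"
  have unit: "D (?e x) = 0" if "x \<in> P" for x
    using wf_trancl[OF wf] that
  proof (induction x rule: wf_induct_rule)
    case (less x)
    \<comment> \<open>The up-set indicator at \<open>x\<close> is the unit vector at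
      \<open>x\<close> plus those at the strictly larger vertices, where the induction hypothesis
      applies.\<close>
    define U where "U = {y. (x, y) \<in> r\<^sup>*} - {x}"
    have UP: "U \<subseteq> P" unfolding U_def using closed less.prems by auto
    have fU: "finite U" using finite_subset[OF UP fin] .
    have z: "D (?e y) = 0" if "y \<in> U" for y
    proof (rule less.IH)
      have "(x, y) \<in> r\<^sup>+" using that unfolding U_def by (auto simp: rtrancl_eq_or_trancl)
      then show "(y, x) \<in> (r\<inverse>)\<^sup>+" by (simp add: trancl_converse)
    qed (use that UP in auto)
    have eK: "?e y \<in> K0 P" if "y \<in> P" for y using that by (auto simp: K0_def)
    have sK: "(\<lambda>w. \<Sum>y\<in>U. ?e y w) \<in> K0 P" using UP by (auto simp: K0_def intro!: sum.neutral)
    have "(\<lambda>w. if (x, w) \<in> r\<^sup>* then 1 else 0) = (\<lambda>w. ?e x w + (\<Sum>y\<in>U. ?e y w))"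
    proof
      fix w
      have "(\<Sum>y\<in>U. ?e y w) = (if w \<in> U then 1 else 0)" using fU by (simp add: sum.delta)
      then show "(if (x, w) \<in> r\<^sup>* then 1 else 0) = ?e x w + (\<Sum>y\<in>U. ?e y w)"
        by (auto simp: U_def)
    qed
    then have "0 = D (\<lambda>w. ?e x w + (\<Sum>y\<in>U. ?e y w))" using up[OF less.prems] by simp
    also have "\<dots> = D (?e x) + D (\<lambda>w. \<Sum>y\<in>U. ?e y w)"
      by (rule K0_hom_add[OF D eK[OF less.prems] sK])
    also have "D (\<lambda>w. \<Sum>y\<in>U. ?e y w) = (\<Sum>y\<in>U. D (?e y))"
      using UP by (intro K0_hom_sum[OF D fU] eK) auto
    also have "\<dots> = 0" using z by simp
    finally show ?case by simp
  qed
  have eK: "?e x \<in> K0 P" if "x \<in> P" for x using that by (auto simp: K0_def)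
  have "d = (\<lambda>w. \<Sum>x\<in>P. d x * ?e x w)"
  proof
    fix w
    have "(\<Sum>x\<in>P. d x * ?e x w) = (\<Sum>x\<in>P. if w = x then d x else 0)"
      by (rule sum.cong) auto
    also have "\<dots> = d w" using fin d by (auto simp: K0_def)
    finally show "d w = (\<Sum>x\<in>P. d x * ?e x w)" by simp
  qed
  then have "D d = D (\<lambda>w. \<Sum>x\<in>P. d x * ?e x w)" by simp
  also have "\<dots> = (\<Sum>x\<in>P. D (\<lambda>w. d x * ?e x w))"
    by (intro K0_hom_sum[OF D fin]) (use eK in \<open>auto simp: K0_def\<close>)
  also have "\<dots> = (\<Sum>x\<in>P. of_int (d x) * D (?e x))"
    by (intro sum.cong refl K0_hom_scale[OF D] eK)
  also have "\<dots> = 0" using unit by simp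
  finally show ?thesis .
qed

subsection \<open>Splitting off an interval from a zigzag of vector spaces\<close>

text \<open>This says that \<open>V\<close> is the direct sum of the line through \<open>v\<close>
  and \<open>B\<close>; keeping the generator \<open>v\<close> allows maps to be normalised on the
  lines.\<close>

definition hyperplane_avoiding ::
  "('k::field \<Rightarrow> 'v::ab_group_add \<Rightarrow> 'v) \<Rightarrow> 'v set \<Rightarrow> 'v \<Rightarrow> 'v set \<Rightarrow> bool" where
  "hyperplane_avoiding s V v B \<longleftrightarrow>
     module.subspace s B \<and> B \<subseteq> V \<and> v \<in> V \<and> v \<notin> B \<and> (\<forall>x\<in>V. \<exists>c. x - s c v \<in> B)"

text \<open>\<open>d i\<close> says that \<open>f i\<close> points to the right. The last clause
  closes the right end: an outgoing map kills the line, an incoming one lands in the complement. The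
  left end carries no condition, because the splitting is later begun at the first nonzero
  space.\<close>

definition interval_splitting ::
  "('k::field \<Rightarrow> 'v::ab_group_add \<Rightarrow> 'v) \<Rightarrow> (nat \<Rightarrow> bool) \<Rightarrow> (nat \<Rightarrow> 'v \<Rightarrow> 'v) \<Rightarrow> (nat \<Rightarrow> 'v set)
    \<Rightarrow> nat \<Rightarrow> nat \<Rightarrow> (nat \<Rightarrow> 'v) \<Rightarrow> (nat \<Rightarrow> 'v set) \<Rightarrow> bool" where
  "interval_splitting s d f V a b v B \<longleftrightarrow>
     (\<forall>i\<in>{a..b}. hyperplane_avoiding s (V i) (v i) (B i)) \<and>
     (\<forall>i\<in>{a..<b}. if d i then f i (v i) = v (Suc i) \<and> f i ` B i \<subseteq> B (Suc i)
                  else f i (v (Suc i)) = v i \<and> f i ` B (Suc i) \<subseteq> B i) \<and>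
     (if d b then f b (v b) = 0 else f b ` V (Suc b) \<subseteq> B b)"

context vector_space
begin

text \<open>A basis of \<open>U\<close> together with \<open>v\<close> extends to a basis of
  \<open>V\<close>; deleting \<open>v\<close> from it leaves a basis of \<open>B\<close>.\<close>

lemma hyperplane_avoiding_exists:
  assumes U: "subspace U" "U \<subseteq> V" and V: "subspace V" and v: "v \<in> V" "v \<notin> U"
  obtains B where "hyperplane_avoiding scale V v B" "U \<subseteq> B"
proof -
  obtain BU where BU: "BU \<subseteq> U" "independent BU" "U \<subseteq> span BU"
    using maximal_independent_subset by blast
  then have spU: "span BU = U" using U(1) by (simp add: span_subspace)
  have "independent (insert v BU)"
    using BU(2) v(2) spU by (simp add: independent_insertI)
  moreover have "insert v BU \<subseteq> V" using BU(1) U(2) v(1) by auto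
  ultimately obtain C where C: "insert v BU \<subseteq> C" "C \<subseteq> V" "independent C" "V \<subseteq> span C"
    using maximal_independent_subset_extend by blast
  define B where "B = span (C - {v})"
  have "v \<notin> B" using C(1,3) unfolding B_def by (auto simp: dependent_def)
  moreover have "\<exists>c. x - c *s v \<in> B" if "x \<in> V" for x
    using that C(1,4) span_breakdown_eq[of x v "C - {v}"] unfolding B_def by (auto simp: insert_absorb)
  moreover have "B \<subseteq> V" unfolding B_def using C(2) V by (meson Diff_subset span_minimal subset_trans)
  moreover have "U \<subseteq> B"
  proof -
    have "v \<notin> BU" using v(2) BU(1) by auto
    then show ?thesis unfolding B_def spU[symmetric] using C(1) by (intro span_mono) auto
  qed
  ultimately show ?thesis using that v(1) unfolding hyperplane_avoiding_def B_def by blast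
qed

lemma linear_between_zero:
  "linear_between scale scale U W f \<Longrightarrow> subspace U \<Longrightarrow> f 0 = 0"
  unfolding linear_between_def using subspace_0[of U] by (metis add_cancel_right_right)

lemma linear_between_diff:
  assumes "linear_between scale scale U W f" "subspace U" "u \<in> U" "v \<in> U"
  shows "f (u - v) = f u - f v"
proof -
  have "f ((u - v) + v) = f (u - v) + f v"
    using assms subspace_diff unfolding linear_between_def by blast
  then show ?thesis by simp
qed

lemma linear_between_add:
  "linear_between scale scale U W f \<Longrightarrow> u \<in> U \<Longrightarrow> v \<in> U \<Longrightarrow> f (u + v) = f u + f v"
  unfolding linear_between_def by blast

lemma linear_between_scale:
  "linear_between scale scale U W f \<Longrightarrow> u \<in> U \<Longrightarrow> f (c *s u) = c *s f u"
  unfolding linear_between_def by blast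

lemma linear_between_in:
  "linear_between scale scale U W f \<Longrightarrow> u \<in> U \<Longrightarrow> f u \<in> W"
  unfolding linear_between_def by blast

lemma subspace_image_between:
  assumes f: "linear_between scale scale U W f" and X: "subspace X" "X \<subseteq> U"
  shows "subspace (f ` X)"
proof (rule subspaceI)
  have "linear_between scale scale X W f" using f X(2) unfolding linear_between_def by blast
  then have "f 0 = 0" using X(1) by (rule linear_between_zero)
  then show "0 \<in> f ` X" using subspace_0[OF X(1)] by force
next
  fix x y assume "x \<in> f ` X" "y \<in> f ` X"
  then obtain u v where "u \<in> X" "v \<in> X" "x = f u" "y = f v" by blast
  then show "x + y \<in> f ` X"
    using linear_between_add[OF f, of u v] subspace_add[OF X(1), of u v] X(2) by force
next
  fix c x assume "x \<in> f ` X"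
  then obtain u where "u \<in> X" "x = f u" by blast
  then show "c *s x \<in> f ` X"
    using linear_between_scale[OF f, of u c] subspace_scale[OF X(1), of u c] X(2) by force
qed

lemma subspace_preimage_between:
  assumes f: "linear_between scale scale U W f" and U: "subspace U" and Y: "subspace Y"
  shows "subspace {u \<in> U. f u \<in> Y}"
  using linear_between_zero[OF f U] linear_between_add[OF f] linear_between_scale[OF f]
    subspace_0[OF U] subspace_0[OF Y] subspace_add[OF U] subspace_add[OF Y]
    subspace_scale[OF U] subspace_scale[OF Y]
  by (intro subspaceI) auto

lemma hyperplane_avoiding_preimage:
  assumes f: "linear_between scale scale U W f" and U: "subspace U" and x: "x \<in> U"
    and B: "hyperplane_avoiding scale W (f x) B"
  shows "hyperplane_avoiding scale U x {u \<in> U. f u \<in> B}"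
proof -
  have "\<exists>c. u - c *s x \<in> {u \<in> U. f u \<in> B}" if u: "u \<in> U" for u
  proof -
    obtain c where c: "f u - c *s f x \<in> B"
      using B linear_between_in[OF f u] unfolding hyperplane_avoiding_def by blast
    have cx: "c *s x \<in> U" using subspace_scale[OF U x] .
    have "f (u - c *s x) = f u - c *s f x"
      using linear_between_diff[OF f U u cx] linear_between_scale[OF f x] by simp
    then show ?thesis using c subspace_diff[OF U u cx] by auto
  qed
  then show ?thesis
    using B x subspace_preimage_between[OF f U, of B] unfolding hyperplane_avoiding_def by auto
qed

lemma interval_splitting_step:
  assumes S: "interval_splitting scale d f V (Suc a) b v B" and "Suc a \<le> b"
    and H: "hyperplane_avoiding scale (V a) x B0"
    and step: "if d a then f a x = v (Suc a) \<and> f a ` B0 \<subseteq> B (Suc a)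
               else f a (v (Suc a)) = x \<and> f a ` B (Suc a) \<subseteq> B0"
  shows "interval_splitting scale d f V a b (v(a := x)) (B(a := B0))"
proof -
  have "{a..b} = insert a {Suc a..b}" "{a..<b} = insert a {Suc a..<b}" using \<open>Suc a \<le> b\<close> by auto
  then show ?thesis using assms unfolding interval_splitting_def by auto
qed

text \<open>The subspaces \<open>X\<close> and \<open>Y\<close> confine the first vector and the first hyperplane; this makes
  the statement strong enough to be pushed along the zigzag in either direction.\<close>

lemma interval_splitting_exists:
  fixes V :: "nat \<Rightarrow> 'b set" and f :: "nat \<Rightarrow> 'b \<Rightarrow> 'b"
  assumes V: "\<And>i. subspace (V i)"
    and fwd: "\<And>i. d i \<Longrightarrow> linear_between scale scale (V i) (V (Suc i)) (f i)"
    and bwd: "\<And>i. \<not> d i \<Longrightarrow> linear_between scale scale (V (Suc i)) (V i) (f i)"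
    and zero: "\<And>i. N < i \<Longrightarrow> V i = {0}"
    and X: "subspace X" "X \<subseteq> V a" and Y: "subspace Y" "Y \<subseteq> X" and ne: "\<not> X \<subseteq> Y"
  shows "\<exists>b v B. a \<le> b \<and> v a \<in> X \<and> Y \<subseteq> B a \<and> interval_splitting scale d f V a b v B"
  using X Y ne
proof (induction "Suc N - a" arbitrary: a X Y rule: less_induct)
  case less
  have "a \<le> N"
  proof (rule ccontr)
    assume "\<not> a \<le> N"
    then have "X \<subseteq> {0}" using zero[of a] less.prems by auto
    then show False using less.prems(5) subspace_0[OF less.prems(3)] by auto
  qed
  then have dec: "Suc N - Suc a < Suc N - a" by simp
  \<comment> \<open>The case where the interval is just \<open>a\<close>; constant families suffice
    because only their values at \<open>a\<close> are inspected.\<close>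
  have stop: ?case if x: "x \<in> X" and B0: "hyperplane_avoiding scale (V a) x B0" "Y \<subseteq> B0"
    and fin: "if d a then f a x = 0 else f a ` V (Suc a) \<subseteq> B0" for x B0
    using that by (intro exI[of _ a] exI[of _ "\<lambda>_. x"] exI[of _ "\<lambda>_. B0"])
      (simp add: interval_splitting_def)
  have YV: "Y \<subseteq> V a" using less.prems by auto
  show ?case
  proof (cases "d a")
    case True
    note f = fwd[OF True]
    show ?thesis
    proof (cases "\<exists>x\<in>X. f a x = 0 \<and> x \<notin> Y")
      case True
      then obtain x where x: "x \<in> X" "f a x = 0" "x \<notin> Y" by blast
      obtain B0 where "hyperplane_avoiding scale (V a) x B0" "Y \<subseteq> B0"
        using hyperplane_avoiding_exists[OF less.prems(3) YV V, of x] x less.prems(2) by blast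
      then show ?thesis using stop x \<open>d a\<close> by simp
    next
      case False
      obtain x where x: "x \<in> X" "x \<notin> Y" using less.prems by blast
      \<comment> \<open>On \<open>X\<close> the kernel of \<open>f a\<close> is now contained in
        \<open>Y\<close>, so mapping forward keeps \<open>X\<close> from falling into
        \<open>Y\<close>, and the images can replace both spaces.\<close>
      have "f a x \<notin> f a ` Y"
      proof
        assume "f a x \<in> f a ` Y"
        then obtain y where y: "y \<in> Y" "f a x = f a y" by blast
        have "f a (x - y) = 0" using linear_between_diff[OF f V, of x y] x y YV less.prems(2) by auto
        moreover have "x - y \<in> X" using subspace_diff[OF less.prems(1), of x y] x y less.prems(4) by auto
        ultimately have "x - y \<in> Y" using False by blast
        then show False using subspace_add[OF less.prems(3), of "x - y" y] x y by simp
      qed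
      then have "\<exists>b v B. Suc a \<le> b \<and> v (Suc a) \<in> f a ` X \<and> f a ` Y \<subseteq> B (Suc a) \<and>
          interval_splitting scale d f V (Suc a) b v B"
        using less.prems x YV linear_between_in[OF f]
        by (intro less.hyps[OF dec] subspace_image_between[OF f] image_mono) auto
      then obtain b v B where b: "Suc a \<le> b" and v: "v (Suc a) \<in> f a ` X" and B: "f a ` Y \<subseteq> B (Suc a)"
        and S: "interval_splitting scale d f V (Suc a) b v B" by blast
      obtain x0 where x0: "x0 \<in> X" "v (Suc a) = f a x0" using v by blast
      \<comment> \<open>The hyperplane found at \<open>Suc a\<close> is pulled back; it contains
        \<open>Y\<close> because it was chosen to contain the image of \<open>Y\<close>.\<close>
      define B0 where "B0 = {u \<in> V a. f a u \<in> B (Suc a)}"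
      have "hyperplane_avoiding scale (V (Suc a)) (f a x0) (B (Suc a))"
        using S b unfolding interval_splitting_def x0(2)[symmetric] by auto
      then have "hyperplane_avoiding scale (V a) x0 B0"
        using x0(1) less.prems(2) unfolding B0_def
        by (intro hyperplane_avoiding_preimage[OF f V]) auto
      then have "interval_splitting scale d f V a b (v(a := x0)) (B(a := B0))"
        using x0 \<open>d a\<close> by (intro interval_splitting_step[OF S b]) (auto simp: B0_def)
      moreover have "Y \<subseteq> B0" using B YV unfolding B0_def by auto
      ultimately show ?thesis using b x0
        by (intro exI[of _ b] exI[of _ "v(a := x0)"] exI[of _ "B(a := B0)"]) auto
    qed
  next
    case False
    note f = bwd[OF False]
    \<comment> \<open>To end at \<open>a\<close> with an incoming map, the hyperplane must contain
      \<open>Y\<close> and the whole image of \<open>f a\<close>. This is possible as soon as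
      \<open>X\<close> has a vector outside their sum \<open>I\<close>.\<close>
    define I where "I = {y + w | y w. y \<in> Y \<and> w \<in> f a ` V (Suc a)}"
    have fV: "subspace (f a ` V (Suc a))" using subspace_image_between[OF f V] by simp
    have I: "subspace I" unfolding I_def using less.prems(3) fV by (rule subspace_sums)
    have YI: "Y \<subseteq> I" unfolding I_def using subspace_0[OF fV] by force
    have fI: "f a ` V (Suc a) \<subseteq> I" unfolding I_def using subspace_0[OF less.prems(3)] by force
    have IV: "I \<subseteq> V a"
      unfolding I_def using YV linear_between_in[OF f] subspace_add[OF V] by blast
    show ?thesis
    proof (cases "X \<subseteq> I")
      case False
      then obtain x where x: "x \<in> X" "x \<notin> I" by blast
      obtain B0 where "hyperplane_avoiding scale (V a) x B0" "I \<subseteq> B0"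
        using hyperplane_avoiding_exists[OF I IV V, of x] x less.prems(2) by blast
      then show ?thesis using stop[of x B0] x \<open>\<not> d a\<close> YI fI by auto
    next
      case True
      \<comment> \<open>Now each vector of \<open>X\<close> is an image vector up to
        \<open>Y\<close>, so the preimages of \<open>X\<close> and \<open>Y\<close> still satisfy
        the hypothesis that the first is not inside the second.\<close>
      define X' where "X' = {u \<in> V (Suc a). f a u \<in> X}"
      define Y' where "Y' = {u \<in> V (Suc a). f a u \<in> Y}"
      obtain x where x: "x \<in> X" "x \<notin> Y" using less.prems by blast
      then obtain y u where yu: "y \<in> Y" "u \<in> V (Suc a)" "x = y + f a u"
        using True unfolding I_def by blast
      have "f a u \<in> X"
        using subspace_diff[OF less.prems(1), of x y] x yu less.prems(4) by auto
      moreover have "f a u \<notin> Y" using subspace_add[OF less.prems(3) yu(1)] x yu by blast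
      ultimately have "u \<in> X'" "u \<notin> Y'" using yu unfolding X'_def Y'_def by auto
      then have "\<exists>b v B. Suc a \<le> b \<and> v (Suc a) \<in> X' \<and> Y' \<subseteq> B (Suc a) \<and>
          interval_splitting scale d f V (Suc a) b v B"
        using less.prems unfolding X'_def Y'_def
        by (intro less.hyps[OF dec] subspace_preimage_between[OF f V]) auto
      then obtain b v B where b: "Suc a \<le> b" and v: "v (Suc a) \<in> X'" and B: "Y' \<subseteq> B (Suc a)"
        and S: "interval_splitting scale d f V (Suc a) b v B" by blast
      define w where "w = v (Suc a)"
      have H: "hyperplane_avoiding scale (V (Suc a)) w (B (Suc a))"
        using S b unfolding interval_splitting_def w_def by auto
      then have BV: "B (Suc a) \<subseteq> V (Suc a)" "subspace (B (Suc a))" "w \<in> V (Suc a)" "w \<notin> B (Suc a)"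
        unfolding hyperplane_avoiding_def by auto
      \<comment> \<open>The hyperplane at \<open>a\<close> must contain \<open>Y\<close> and the
        image of the one at \<open>Suc a\<close>. It can avoid \<open>f a w\<close>: otherwise
        \<open>w\<close> would differ from a vector of \<open>B (Suc a)\<close> by one of
        \<open>Y'\<close>, which lies in \<open>B (Suc a)\<close> too.\<close>
      define J where "J = {y + z | y z. y \<in> Y \<and> z \<in> f a ` B (Suc a)}"
      have fB: "subspace (f a ` B (Suc a))" using subspace_image_between[OF f BV(2,1)] .
      have J: "subspace J" unfolding J_def using less.prems(3) fB by (rule subspace_sums)
      have YJ: "Y \<subseteq> J" unfolding J_def using subspace_0[OF fB] by force
      have fJ: "f a ` B (Suc a) \<subseteq> J" unfolding J_def using subspace_0[OF less.prems(3)] by force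
      have JV: "J \<subseteq> V a"
        unfolding J_def using YV BV(1) linear_between_in[OF f] subspace_add[OF V] by blast
      have "f a w \<notin> J"
      proof
        assume "f a w \<in> J"
        then obtain y z where yz: "y \<in> Y" "z \<in> B (Suc a)" "f a w = y + f a z"
          unfolding J_def by blast
        have "f a (w - z) = y"
          using linear_between_diff[OF f V, of w z] yz BV by auto
        then have "w - z \<in> Y'"
          using yz BV subspace_diff[OF V, of w "Suc a" z] unfolding Y'_def by auto
        then have "(w - z) + z \<in> B (Suc a)" using B yz(2) subspace_add[OF BV(2)] by blast
        then show False using BV by simp
      qed
      moreover have wX: "f a w \<in> X" using v unfolding X'_def w_def by auto
      ultimately obtain B0 where B0: "hyperplane_avoiding scale (V a) (f a w) B0" "J \<subseteq> B0"
        using hyperplane_avoiding_exists[OF J JV V, of "f a w"] less.prems(2) by blast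
      have "interval_splitting scale d f V a b (v(a := f a w)) (B(a := B0))"
        using B0 fJ \<open>\<not> d a\<close> by (intro interval_splitting_step[OF S b]) (auto simp: w_def)
      then show ?thesis using b wX B0(2) YJ
        by (intro exI[of _ b] exI[of _ "v(a := f a w)"] exI[of _ "B(a := B0)"]) auto
    qed
  qed
qed

lemma dim_span_singleton: "v \<noteq> 0 \<Longrightarrow> dim (span {v}) = 1"
  by (subst dim_span_eq_card_independent) (auto simp: dependent_def)

lemma dim_zero_space: "dim {0} = 0"
  using dim_span_eq_card_independent[OF independent_empty] by simp

text \<open>The finite spanning set matters: \<open>dim\<close> is the cardinality of a basis, which
  is 0 for an infinite one.\<close>

lemma dim_pos:
  assumes "subspace V" "finite S" "span S = V" "V \<noteq> {0}"
  shows "dim V > 0"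
proof (rule ccontr)
  assume "\<not> dim V > 0"
  obtain B where B: "B \<subseteq> V" "independent B" "V \<subseteq> span B" "card B = dim V"
    using basis_exists by blast
  have "finite B" using independent_span_bound[of S B] assms B by auto
  then have "B = {}" using B(4) \<open>\<not> dim V > 0\<close> by simp
  then show False using B(3) assms(1,4) subspace_0 by auto
qed

end

subsection \<open>Indecomposable socle-projective representations are thin intervals\<close>

locale sp_rep = alien_polygon n Q p F + vector_space scale
  for n :: nat and Q F :: "arrow set" and p :: "nat \<Rightarrow> complex"
    and scale :: "'k::field \<Rightarrow> 'v::ab_group_add \<Rightarrow> 'v" +
  fixes M :: "(nat, 'v) poset_rep"
  assumes M: "sp_object scale (verts n) (alien_le n Q F) M"
begin

lemmas sp_objectD = M[unfolded sp_object_def, THEN conjunct1]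
  M[unfolded sp_object_def, THEN conjunct2, THEN conjunct1]
  M[unfolded sp_object_def, THEN conjunct2, THEN conjunct2, THEN conjunct1]
  M[unfolded sp_object_def, THEN conjunct2, THEN conjunct2, THEN conjunct2, THEN conjunct1]
  M[unfolded sp_object_def, THEN conjunct2, THEN conjunct2, THEN conjunct2, THEN conjunct2]

lemma space_subspace: "x \<in> verts n \<Longrightarrow> subspace (spc M x)"
  using sp_objectD(1) by simp

lemma le_verts: "alien_le n Q F x y \<Longrightarrow> x \<in> verts n" "alien_le n Q F x y \<Longrightarrow> y \<in> verts n"
  by (simp_all add: alien_le_def)

lemma str_linear: "alien_le n Q F x y \<Longrightarrow> linear_between scale scale (spc M x) (spc M y) (str M y x)"
  using sp_objectD(2) le_verts by simp

lemma str_id: "x \<in> verts n \<Longrightarrow> v \<in> spc M x \<Longrightarrow> str M x x v = v"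
  using sp_objectD(3) by simp

lemma str_comp:
  "alien_le n Q F x y \<Longrightarrow> alien_le n Q F y w \<Longrightarrow> v \<in> spc M x \<Longrightarrow> str M w y (str M y x v) = str M w x v"
  using sp_objectD(4) le_verts by simp

lemma reach_le: "(x, y) \<in> (Q \<union> F)\<^sup>* \<Longrightarrow> x \<in> verts n \<Longrightarrow> alien_le n Q F x y"
  using reach_verts by (auto simp: alien_le_def)

lemma arrow_le: "(x, y) \<in> Q \<union> F \<Longrightarrow> alien_le n Q F x y"
  using arrow_verts by (auto simp: alien_le_def)

lemma max_elt_sink:
  assumes "z \<in> max_elts (verts n) (alien_le n Q F)"
  shows "sink n Q z"
  unfolding sink_def
proof (intro conjI allI)
  show "z \<in> verts n" using assms by (simp add: max_elts_def)
  show "(z, y) \<notin> Q" for y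
  proof
    assume e: "(z, y) \<in> Q"
    then have "alien_le n Q F z y" by (intro arrow_le) simp
    then have "y = z" using assms unfolding max_elts_def alien_le_def by blast
    then show False using edge[OF e] by simp
  qed
qed

text \<open>The target of an alien arrow lies below a single sink, so the socle condition at the
  target is injectivity of one map.\<close>

lemma str_injective_at_alien_target:
  assumes "(x, y) \<in> F" "sink n Q i" "y \<in> supp_inj n Q i" "v \<in> spc M y" "str M i y v = 0"
  shows "v = 0"
proof -
  have yi: "alien_le n Q F y i" and y: "y \<in> verts n"
    using assms(3) by (auto simp: supp_inj_def intro!: reach_le reach_Q)
  show ?thesis
  proof (cases "y \<in> max_elts (verts n) (alien_le n Q F)")
    case True
    then have "i = y" using yi unfolding max_elts_def alien_le_def by blast
    then show ?thesis using str_id[OF y assms(4)] assms(5) by simp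
  next
    case False
    \<comment> \<open>A maximal vertex above \<open>y\<close> is a sink in the support of
      \<open>I(i)\<close>, hence \<open>i\<close> itself, so the intersection of kernels is a single
      kernel.\<close>
    have "str M z y v = 0" if z: "z \<in> max_elts (verts n) (alien_le n Q F)" "alien_le n Q F y z" for z
    proof -
      have "z \<in> supp_inj n Q i"
        using alien_target_unique_sink[OF assms(1-3)] z(2) by (simp add: alien_le_def)
      then have "(z, i) \<in> Q\<^sup>*" by (simp add: supp_inj_def)
      then have "z = i" using max_elt_sink[OF z(1)] by (metis converse_rtranclE sink_def)
      then show ?thesis using assms(5) by simp
    qed
    moreover have "{v \<in> spc M y. \<forall>z\<in>max_elts (verts n) (alien_le n Q F). alien_le n Q F y z \<longrightarrow> str M z y v = 0} = {0}"
      using bspec[OF sp_objectD(5), of y] False y by simp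
    ultimately show ?thesis using assms(4) by blast
  qed
qed

text \<open>Let an alien arrow send a vector of \<open>A x\<close> to \<open>a + b\<close> in
  \<open>A y\<close> plus \<open>B y\<close>. At the common sink, reached from both ends along
  \<open>Q\<close>, the image of \<open>b\<close> lies in \<open>A\<close> as a difference and in
  \<open>B\<close> by its own path, so it vanishes, and injectivity gives \<open>b = 0\<close>. The
  hypotheses are symmetric, so the conclusion holds for \<open>B\<close> as well.\<close>

lemma splitting_respects_alien_arrows:
  assumes A: "\<And>x. x \<in> verts n \<Longrightarrow> subspace (A x) \<and> A x \<subseteq> spc M x"
    and B: "\<And>x. x \<in> verts n \<Longrightarrow> subspace (B x) \<and> B x \<subseteq> spc M x"
    and disj: "\<And>x. x \<in> verts n \<Longrightarrow> A x \<inter> B x = {0}"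
    and sum: "\<And>x v. x \<in> verts n \<Longrightarrow> v \<in> spc M x \<Longrightarrow> \<exists>a\<in>A x. \<exists>b\<in>B x. v = a + b"
    and QA: "\<And>x y. (x, y) \<in> Q \<Longrightarrow> str M y x ` A x \<subseteq> A y"
    and QB: "\<And>x y. (x, y) \<in> Q \<Longrightarrow> str M y x ` B x \<subseteq> B y"
    and le: "alien_le n Q F x y"
  shows "str M y x ` A x \<subseteq> A y"
proof -
  \<comment> \<open>A general family and arrow set are used because this is applied to
    \<open>A\<close> and to \<open>B\<close> along \<open>Q\<close>, and at the end to
    \<open>A\<close> along all arrows.\<close>
  have path: "str M y x ` C x \<subseteq> C y"
    if C: "\<And>x. x \<in> verts n \<Longrightarrow> subspace (C x) \<and> C x \<subseteq> spc M x"
      and R: "R \<subseteq> Q \<union> F" and arrow: "\<And>x y. (x, y) \<in> R \<Longrightarrow> str M y x ` C x \<subseteq> C y"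
      and r: "(x, y) \<in> R\<^sup>*" and x: "x \<in> verts n" for C R x y
    using r
  proof (induction rule: rtrancl_induct)
    case base
    then show ?case using str_id[OF x] C[OF x] by force
  next
    case (step y z)
    have xy: "alien_le n Q F x y"
      using step.hyps(1) x rtrancl_mono[OF R] by (intro reach_le) auto
    moreover have yz: "alien_le n Q F y z" using step.hyps(2) R by (intro arrow_le) auto
    have "str M z x u \<in> C z" if "u \<in> C x" for u
    proof -
      have "str M z y (str M y x u) \<in> C z" using step.IH arrow[OF step.hyps(2)] that by blast
      then show ?thesis using str_comp[OF xy yz] C[OF x] that by auto
    qed
    then show ?case by blast
  qed
  have "str M y x ` A x \<subseteq> A y" if F: "(x, y) \<in> F" for x y
  proof
    fix w assume "w \<in> str M y x ` A x"
    then obtain u where u: "u \<in> A x" "w = str M y x u" by blast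
    have x: "x \<in> verts n" and y: "y \<in> verts n" using arrow_verts[of x y] F by auto
    have xy: "alien_le n Q F x y" using F by (intro arrow_le) simp
    obtain i where i: "sink n Q i" "x \<in> supp_inj n Q i" "y \<in> supp_inj n Q i" using alien_arrowE[OF F] .
    have Qp: "(x, i) \<in> Q\<^sup>*" "(y, i) \<in> Q\<^sup>*" and iv: "i \<in> verts n"
      using i by (auto simp: supp_inj_def sink_def)
    have yi: "alien_le n Q F y i" using Qp(2) y by (intro reach_le reach_Q)
    have uM: "u \<in> spc M x" using u A[OF x] by blast
    have wM: "w \<in> spc M y" using linear_between_in[OF str_linear[OF xy] uM] u by simp
    obtain a b where ab: "a \<in> A y" "b \<in> B y" "w = a + b" using sum[OF y wM] by blast
    have aM: "a \<in> spc M y" and bM: "b \<in> spc M y" using ab A[OF y] B[OF y] by auto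
    have "str M i y w = str M i x u" using str_comp[OF xy yi uM] u by simp
    moreover have "str M i x u \<in> A i" using path[OF A _ QA Qp(1) x] u(1) by blast
    moreover have "str M i y a \<in> A i" using path[OF A _ QA Qp(2) y] ab(1) by blast
    moreover have "str M i y w = str M i y a + str M i y b"
      using linear_between_add[OF str_linear[OF yi] aM bM] ab(3) by simp
    ultimately have "str M i x u \<in> A i" "str M i y a \<in> A i" "str M i y b = str M i x u - str M i y a"
      by (simp_all add: algebra_simps)
    then have "str M i y b \<in> A i" using subspace_diff A[OF iv] by simp
    moreover have "str M i y b \<in> B i" using path[OF B _ QB Qp(2) y] ab(2) by blast
    ultimately have "str M i y b = 0" using disj[OF iv] by blast
    then have "b = 0" using str_injective_at_alien_target[OF F i(1,3) bM] by simp
    then show "w \<in> A y" using ab by simp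
  qed
  then have "str M y x ` A x \<subseteq> A y" if "(x, y) \<in> Q \<union> F" for x y using that QA by blast
  then show ?thesis using path[OF A order_refl] le unfolding alien_le_def by blast
qed

text \<open>The lines of an interval splitting and their complements, the latter extended by the
  full spaces outside the interval, decompose the object. The lines are nonzero, so the complements
  vanish. The generators are normalised so that arrows of \<open>Q\<close> within the interval carry
  generators to generators.\<close>

lemma indecomposable_thin_interval:
  assumes ind: "indecomposable scale (verts n) (alien_le n Q F) M"
  obtains a b v where "1 \<le> a" "a \<le> b" "b \<le> n + 2"
    "\<And>x. x \<in> {a..b} \<Longrightarrow> v x \<noteq> 0 \<and> spc M x = span {v x}"
    "\<And>x. x \<in> verts n - {a..b} \<Longrightarrow> spc M x = {0}"
    "\<And>x y. x \<in> {a..b} \<Longrightarrow> y \<in> {a..b} \<Longrightarrow> (x, y) \<in> Q \<Longrightarrow> str M y x (v x) = v y"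
proof -
  define V where "V x = (if x \<in> verts n then spc M x else {0})" for x
  define d where "d i \<longleftrightarrow> (i, Suc i) \<in> Q" for i
  \<comment> \<open>Where \<open>Q\<close> has no arrow between \<open>i\<close> and
    \<open>Suc i\<close>, beyond the ends of the quiver, \<open>i\<close> counts as pointing left
    and gets the zero map.\<close>
  define f where "f i = (if d i then str M (Suc i) i else if (Suc i, i) \<in> Q then str M i (Suc i) else (\<lambda>_. 0))" for i
  \<comment> \<open>Starting at the first nonzero space, every map across the left end has zero
    source or zero target.\<close>
  define a where "a = (LEAST x. x \<in> verts n \<and> spc M x \<noteq> {0})"
  have "\<exists>x. x \<in> verts n \<and> spc M x \<noteq> {0}"
    using ind unfolding indecomposable_def zero_rep_def by blast
  then have a: "a \<in> verts n" "spc M a \<noteq> {0}"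
    unfolding a_def by (metis (mono_tags, lifting) LeastI)+
  have below: "V x = {0}" if "x < a" for x
    using not_less_Least[OF that[unfolded a_def]] by (auto simp: V_def)
  have VM: "V x = spc M x" if "x \<in> verts n" for x using that by (simp add: V_def)
  have Vs: "subspace (V x)" for x using space_subspace by (simp add: V_def)
  have fQ: "linear_between scale scale (V x) (V y) (str M y x)" if "(x, y) \<in> Q" for x y
    using str_linear[OF arrow_le[of x y]] arrow_verts[of x y] VM that by simp
  have fwd: "linear_between scale scale (V i) (V (Suc i)) (f i)" if "d i" for i
    using fQ[of i "Suc i"] that by (simp add: f_def d_def)
  have bwd: "linear_between scale scale (V (Suc i)) (V i) (f i)" if "\<not> d i" for i
  proof (cases "(Suc i, i) \<in> Q")
    case True
    then show ?thesis using fQ[of "Suc i" i] that by (simp add: f_def)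
  next
    case False
    then show ?thesis using that subspace_0[OF Vs] by (auto simp: f_def linear_between_def)
  qed
  have zero: "V i = {0}" if "n + 2 < i" for i using that by (auto simp: V_def verts_def)
  obtain b v B where ab: "a \<le> b" and S: "interval_splitting scale d f V a b v B"
  proof -
    have "\<not> V a \<subseteq> {0}" using a VM[OF a(1)] subspace_0[OF Vs[of a]] by auto
    then have "\<exists>b v B. a \<le> b \<and> v a \<in> V a \<and> {0} \<subseteq> B a \<and> interval_splitting scale d f V a b v B"
      using subspace_0[OF Vs[of a]]
      by (intro interval_splitting_exists[where N = "n + 2"] Vs fwd bwd zero) auto
    then show ?thesis using that by blast
  qed
  have H: "subspace (B x)" "B x \<subseteq> V x" "v x \<in> V x" "v x \<notin> B x" "\<And>u. u \<in> V x \<Longrightarrow> \<exists>c. u - scale c (v x) \<in> B x"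
    if "x \<in> {a..b}" for x
    using S that unfolding interval_splitting_def hyperplane_avoiding_def by blast+
  have v0: "v x \<noteq> 0" if "x \<in> {a..b}" for x using H[OF that] subspace_0 by metis
  have bv: "b \<le> n + 2" using H(3)[of b] v0[of b] zero[of b] ab by fastforce
  have av: "1 \<le> a" using a by (simp add: verts_def)
  have inv: "x \<in> verts n" if "x \<in> {a..b}" for x using that av bv by (auto simp: verts_def)
  have Sd: "if d i then f i (v i) = v (Suc i) \<and> f i ` B i \<subseteq> B (Suc i)
            else f i (v (Suc i)) = v i \<and> f i ` B (Suc i) \<subseteq> B i" if "a \<le> i" "i < b" for i
    using S that unfolding interval_splitting_def by auto
  have Sb: "if d b then f b (v b) = 0 else f b ` V (Suc b) \<subseteq> B b"
    using S unfolding interval_splitting_def by blast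
  define B' where "B' x = (if x \<in> {a..b} then B x else V x)" for x
  define A where "A x = (if x \<in> {a..b} then span {v x} else {0})" for x
  have BV: "B' x \<subseteq> V x" for x using H(2) by (auto simp: B'_def)
  have key_v: "str M y x (v x) = (if y \<in> {a..b} then v y else 0)" if x: "x \<in> {a..b}" and e: "(x, y) \<in> Q" for x y
  proof -
    have yV: "str M y x (v x) \<in> V y" using linear_between_in[OF fQ[OF e]] H(3)[OF x] .
    consider "y = Suc x" | "x = Suc y" using edge[OF e] by auto
    then show ?thesis
    proof cases
      case 1
      then have "f x = str M y x" "d x" using e by (auto simp: f_def d_def)
      then show ?thesis using 1 x Sd[of x] Sb by (cases "x = b") auto
    next
      case 2
      then have nd: "\<not> d y" using e edge_orient by (auto simp: d_def)
      then have "f y = str M y x" using e 2 by (auto simp: f_def)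
      then show ?thesis using 2 x nd Sd[of y] below[of y] yV by (cases "x = a") auto
    qed
  qed
  have key_B: "str M y x ` B' x \<subseteq> B' y" if e: "(x, y) \<in> Q" for x y
  proof -
    have img: "str M y x ` V x \<subseteq> V y" using linear_between_in[OF fQ[OF e]] by blast
    show ?thesis
    proof (cases "y \<in> {a..b}")
      case False
      then have "B' y = V y" by (auto simp: B'_def)
      then show ?thesis using img BV[of x] by blast
    next
      case y: True
      consider "y = Suc x" | "x = Suc y" using edge[OF e] by auto
      then show ?thesis
      proof cases
        case 1
        then have f: "f x = str M y x" "d x" using e by (auto simp: f_def d_def)
        show ?thesis
        proof (cases "x \<in> {a..b}")
          case True
          then show ?thesis using f 1 y Sd[of x] by (auto simp: B'_def)
        next
          case False
          then have "V x = {0}" using below[of x] 1 y by auto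
          moreover have "str M y x 0 = 0" using linear_between_zero[OF fQ[OF e] Vs] .
          moreover have "0 \<in> B' y" using subspace_0[OF H(1)[OF y]] y by (simp add: B'_def)
          ultimately show ?thesis using BV[of x] by auto
        qed
      next
        case 2
        then have nd: "\<not> d y" using e edge_orient by (auto simp: d_def)
        then have f: "f y = str M y x" using e 2 by (auto simp: f_def)
        show ?thesis
        proof (cases "x \<in> {a..b}")
          case True
          then show ?thesis using f nd 2 y Sd[of y] by (auto simp: B'_def)
        next
          case False
          \<comment> \<open>An arrow entering from the right of the interval: the last clause of the
            splitting sends all of \<open>V (Suc b)\<close> into the complement.\<close>
          then have "y = b" using 2 y by auto
          then show ?thesis using f nd 2 y Sb BV[of x] by (auto simp: B'_def)
        qed
      qed
    qed
  qed
  have key_A: "str M y x ` A x \<subseteq> A y" if e: "(x, y) \<in> Q" for x y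
  proof (cases "x \<in> {a..b}")
    case True
    have "str M y x (scale c (v x)) = scale c (if y \<in> {a..b} then v y else 0)" for c
      using linear_between_scale[OF fQ[OF e] H(3)[OF True]] key_v[OF True e] by simp
    then show ?thesis using True by (auto simp: A_def span_singleton)
  next
    case False
    then show ?thesis using linear_between_zero[OF fQ[OF e] Vs] by (auto simp: A_def span_zero)
  qed
  have Asub: "subspace (A x) \<and> A x \<subseteq> spc M x" if "x \<in> verts n" for x
  proof -
    have "span {v x} \<subseteq> V x" if "x \<in> {a..b}" using H(3)[OF that] by (intro span_minimal Vs) auto
    then show ?thesis using that VM[OF that] subspace_0[OF Vs[of x]] by (auto simp: A_def)
  qed
  have Bsub: "subspace (B' x) \<and> B' x \<subseteq> spc M x" if "x \<in> verts n" for x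
    using BV[of x] VM[OF that] H(1)[of x] Vs[of x] by (auto simp: B'_def)
  have disj: "A x \<inter> B' x = {0}" if "x \<in> verts n" for x
  proof (cases "x \<in> {a..b}")
    case True
    have "scale c (v x) = 0" if "scale c (v x) \<in> B x" for c
    proof (rule ccontr)
      assume "scale c (v x) \<noteq> 0"
      then have "v x = scale (inverse c) (scale c (v x))" by auto
      then show False using subspace_scale[OF H(1)[OF True] that, of "inverse c"] H(4)[OF True] by metis
    qed
    then show ?thesis using True subspace_0[OF H(1)[OF True]] span_zero[of "{v x}"]
      by (auto simp: A_def B'_def span_singleton)
  next
    case False
    then show ?thesis using subspace_0[OF Vs[of x]] by (auto simp: A_def B'_def)
  qed
  have sum: "\<exists>u\<in>A x. \<exists>w\<in>B' x. z = u + w" if x: "x \<in> verts n" and z: "z \<in> spc M x" for x z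
  proof (cases "x \<in> {a..b}")
    case True
    obtain c where "z - scale c (v x) \<in> B x" using H(5)[OF True] z VM[OF x] by blast
    moreover have "scale c (v x) \<in> A x" using True by (auto simp: A_def span_singleton)
    moreover have "z = scale c (v x) + (z - scale c (v x))" by simp
    ultimately show ?thesis using True unfolding B'_def by metis
  next
    case False
    then show ?thesis using z VM[OF x] by (auto simp: A_def B'_def)
  qed
  have "str M y x ` A x \<subseteq> A y" if "alien_le n Q F x y" for x y
    using splitting_respects_alien_arrows[of A B', OF Asub Bsub disj sum key_A key_B that] .
  then have rA: "subrep scale (verts n) (alien_le n Q F) \<lparr>spc = A, str = str M\<rparr> M"
    using Asub unfolding subrep_def by simp
  have "str M y x ` B' x \<subseteq> B' y" if "alien_le n Q F x y" for x y
  proof (rule splitting_respects_alien_arrows[of B' A, OF Bsub Asub _ _ key_B key_A that])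
    show "B' x \<inter> A x = {0}" if "x \<in> verts n" for x using disj[OF that] by blast
    show "\<exists>u\<in>B' x. \<exists>w\<in>A x. z = u + w" if "x \<in> verts n" "z \<in> spc M x" for x z
      using sum[OF that] by (metis add.commute)
  qed
  then have rB: "subrep scale (verts n) (alien_le n Q F) \<lparr>spc = B', str = str M\<rparr> M"
    using Bsub unfolding subrep_def by simp
  have direct: "{u + w | u w. u \<in> A x \<and> w \<in> B' x} = spc M x" if x: "x \<in> verts n" for x
    using sum[OF x] Asub[OF x] Bsub[OF x] subspace_add[OF space_subspace[OF x]] by blast
  have "zero_rep (verts n) \<lparr>spc = A, str = str M\<rparr> \<or> zero_rep (verts n) \<lparr>spc = B', str = str M\<rparr>"
    using ind rA rB disj direct unfolding indecomposable_def by simp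
  moreover have "\<not> zero_rep (verts n) \<lparr>spc = A, str = str M\<rparr>"
  proof -
    have "v a \<in> A a" using ab by (simp add: A_def span_base)
    then show ?thesis using a(1) v0[of a] ab unfolding zero_rep_def by auto
  qed
  ultimately have B0: "B' x = {0}" if "x \<in> verts n" for x using that unfolding zero_rep_def by auto
  have MA: "spc M x = A x" if x: "x \<in> verts n" for x
    using sum[OF x] Asub[OF x] B0[OF x] by fastforce
  show ?thesis
  proof (rule that[OF av ab bv])
    show "v x \<noteq> 0 \<and> spc M x = span {v x}" if "x \<in> {a..b}" for x
      using v0[OF that] MA[OF inv[OF that]] that by (simp add: A_def)
    show "spc M x = {0}" if "x \<in> verts n - {a..b}" for x
      using MA[of x] that by (auto simp: A_def)
    show "str M y x (v x) = v y" if "x \<in> {a..b}" "y \<in> {a..b}" "(x, y) \<in> Q" for x y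
      using key_v[OF that(1,3)] that(2) by simp
  qed
qed

end

subsection \<open>The central charge\<close>

text \<open>The vertices of the quiver start at 1, so \<open>x - 1\<close> is never truncated and
  each unit vector goes to the step between horizontally consecutive corners.\<close>

definition polygon_charge :: "nat \<Rightarrow> (nat \<Rightarrow> complex) \<Rightarrow> (nat \<Rightarrow> int) \<Rightarrow> complex" where
  "polygon_charge n p d = (\<Sum>x\<in>verts n. of_int (d x) * (p x - p (x - 1)))"

lemma polygon_charge_hom: "K0_hom (verts n) (polygon_charge n p)"
  unfolding K0_hom_def polygon_charge_def by (simp add: sum.distrib distrib_right)

lemma polygon_charge_indicator:
  assumes "S \<subseteq> verts n"
  shows "polygon_charge n p (\<lambda>x. if x \<in> S then 1 else 0) = (\<Sum>x\<in>S. p x - p (x - 1))"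
proof -
  have "polygon_charge n p (\<lambda>x. if x \<in> S then 1 else 0) = (\<Sum>x\<in>verts n. if x \<in> S then p x - p (x - 1) else 0)"
    unfolding polygon_charge_def by (rule sum.cong) auto
  also have "\<dots> = (\<Sum>x\<in>S. p x - p (x - 1))"
    using assms by (subst sum.inter_restrict[symmetric]) (auto simp: verts_def Int_absorb1)
  finally show ?thesis .
qed

lemma polygon_charge_interval:
  assumes "s < m" "m \<le> n + 2"
  shows "polygon_charge n p (\<lambda>x. if x \<in> {s + 1..m} then 1 else 0) = seg_vec p (s, m)"
proof -
  have "{s + 1..m} \<subseteq> verts n" using assms by (auto simp: verts_def)
  then show ?thesis
    using sum_telescope''[of s m p] assms(1) by (simp only: polygon_charge_indicator seg_vec_def) simp
qed

lemma summation_by_parts: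
  fixes h ch :: "nat \<Rightarrow> real"
  assumes "a \<le> b"
  shows "(\<Sum>x\<in>{a..b}. ch x * (h x - h (x - 1)))
    = ch b * h b - ch a * h (a - 1) + (\<Sum>x\<in>{a..<b}. h x * (ch x - ch (x + 1)))"
  using assms
proof (induction b rule: dec_induct)
  case base
  then show ?case by (simp add: algebra_simps)
next
  case (step b)
  then show ?case by (simp add: sum.cl_ivl_Suc algebra_simps)
qed

context type_A_polygon
begin

text \<open>The height over the chord vanishes at both ends, so summation by parts leaves only
  interior vertices at which membership in \<open>S\<close> changes. Closure under \<open>Q\<close>
  allows such a change at an upper vertex only on entering \<open>S\<close> from the left and at a
  lower one only on leaving it; either way the term is negative.\<close>

lemma cross_closed_subset_neg:
  assumes ab: "1 \<le> a" "a \<le> b" "b \<le> n + 2" and S: "S \<subseteq> {a..b}" "S \<noteq> {}" "S \<noteq> {a..b}"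
    and closed: "\<And>x y. x \<in> S \<Longrightarrow> y \<in> {a..b} \<Longrightarrow> (x, y) \<in> Q \<Longrightarrow> y \<in> S"
  shows "(\<Sum>x\<in>S. cross p (a - 1) b x - cross p (a - 1) b (x - 1)) < 0"
proof -
  define h where "h = cross p (a - 1) b"
  define ch where "ch x = (if x \<in> S then 1 else 0::real)" for x
  have ends: "h (a - 1) = 0" "h b = 0" by (simp_all add: h_def cross_coords)
  have nonpos: "h x * (ch x - ch (x + 1)) \<le> 0"
    and neg: "ch x \<noteq> ch (x + 1) \<Longrightarrow> h x * (ch x - ch (x + 1)) < 0" if x: "x \<in> {a..<b}" for x
  proof -
    have "h x * (ch x - ch (x + 1)) \<le> 0 \<and> (ch x \<noteq> ch (x + 1) \<longrightarrow> h x * (ch x - ch (x + 1)) < 0)"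
    proof (cases "x \<in> upper n Q")
      case True
      then have "h x > 0" unfolding h_def using x ab by (intro upper_above_chord) auto
      moreover have "x \<in> S \<Longrightarrow> x + 1 \<in> S" using True closed[of x "x + 1"] x by (auto simp: upper_def)
      ultimately show ?thesis by (auto simp: ch_def)
    next
      case False
      then have l: "x \<in> lower n Q" using upper_or_lower[of x] x ab by auto
      then have "h x < 0" unfolding h_def using x ab by (intro lower_below_chord) auto
      moreover have "x + 1 \<in> S \<Longrightarrow> x \<in> S" using l closed[of "x + 1" x] x by (auto simp: lower_def)
      ultimately show ?thesis by (auto simp: ch_def)
    qed
    then show "h x * (ch x - ch (x + 1)) \<le> 0" "ch x \<noteq> ch (x + 1) \<Longrightarrow> h x * (ch x - ch (x + 1)) < 0" by auto
  qed
  \<comment> \<open>Without a change of membership \<open>S\<close> would be empty or the whole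
    interval; the change makes one term strictly negative.\<close>
  have jump: "\<exists>x\<in>{a..<b}. ch x \<noteq> ch (x + 1)"
  proof (rule ccontr)
    assume "\<not> ?thesis"
    then have const: "ch x = ch (x + 1)" if "a \<le> x" "x < b" for x using that by auto
    have all: "ch x = ch a" if "a \<le> x" "x \<le> b" for x
      using that
    proof (induction x rule: dec_induct)
      case (step x)
      then show ?case using const[of x] by simp
    qed simp
    obtain x where x: "x \<in> S" using S(2) by blast
    have "ch a = 1" using all[of x] x subsetD[OF S(1) x] by (simp add: ch_def split: if_splits)
    then have "y \<in> S" if "y \<in> {a..b}" for y using all[of y] that by (auto simp: ch_def split: if_splits)
    then show False using S(1,3) by blast
  qed
  have "(\<Sum>x\<in>S. h x - h (x - 1)) = (\<Sum>x\<in>{a..b}. ch x * (h x - h (x - 1)))"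
  proof -
    have "(\<Sum>x\<in>{a..b}. ch x * (h x - h (x - 1))) = (\<Sum>x\<in>{a..b}. if x \<in> S then h x - h (x - 1) else 0)"
      by (rule sum.cong) (auto simp: ch_def)
    also have "\<dots> = (\<Sum>x\<in>S. h x - h (x - 1))"
      using S(1) by (subst sum.inter_restrict[symmetric]) (auto simp: Int_absorb1)
    finally show ?thesis by simp
  qed
  also have "\<dots> = (\<Sum>x\<in>{a..<b}. h x * (ch x - ch (x + 1)))"
    using summation_by_parts[OF ab(2), of ch h] ends by simp
  also have "\<dots> < (\<Sum>x\<in>{a..<b}. 0)"
  proof (rule sum_strict_mono_ex1)
    show "\<forall>x\<in>{a..<b}. h x * (ch x - ch (x + 1)) \<le> 0" using nonpos by blast
    show "\<exists>x\<in>{a..<b}. h x * (ch x - ch (x + 1)) < 0" using jump neg by blast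
  qed simp
  finally show ?thesis by (simp add: h_def)
qed

lemma Re_polygon_charge_pos:
  assumes "\<And>x. x \<in> verts n \<Longrightarrow> d x \<ge> 0" "y \<in> verts n" "d y > 0"
  shows "Re (polygon_charge n p d) > 0"
proof -
  have step: "Re (p x) - Re (p (x - 1)) > 0" if "x \<in> verts n" for x
    using Re_less[of "x - 1" x] that by (auto simp: verts_def)
  have "0 < (\<Sum>x\<in>verts n. of_int (d x) * (Re (p x) - Re (p (x - 1))))"
  proof (rule sum_pos2[OF _ assms(2)])
    show "0 < of_int (d y) * (Re (p y) - Re (p (y - 1)))" using step assms(2,3) by simp
    show "0 \<le> of_int (d x) * (Re (p x) - Re (p (x - 1)))" if "x \<in> verts n" for x
      using step[OF that] assms(1)[OF that] by simp
  qed (simp add: verts_def)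
  then show ?thesis unfolding polygon_charge_def by simp
qed

end

section \<open>Arguments in the right half-plane\<close>

lemma Arg_right_half_plane:
  assumes "Re z > 0"
  shows "- pi / 2 < Arg z \<and> Arg z < pi / 2"
  using arctan_lbound[of "Im z / Re z"] arctan_ubound[of "Im z / Re z"]
  unfolding arg_conv_arctan[OF assms] by simp

lemma Re_pos_right_half_plane:
  assumes "Re z > 0"
  shows "z \<in> right_half_plane"
proof -
  have "z = complex_of_real (cmod z) * cis (pi * (Arg z / pi))"
    using rcis_cmod_Arg[of z] by (simp add: rcis_def)
  moreover have "cmod z > 0" using assms by auto
  moreover have "- 1 / 2 < Arg z / pi" "Arg z / pi < 1 / 2"
    using Arg_right_half_plane[OF assms] by (simp_all add: field_simps)
  ultimately show ?thesis unfolding right_half_plane_def by blast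
qed

text \<open>In the right half-plane the argument is the arctangent of the slope, and comparing
  slopes with denominators cleared gives the cross product.\<close>

lemma Arg_less_of_cross_neg:
  assumes "Re w > 0" "Re z > 0" "Im (cnj z * w) < 0"
  shows "Arg w < Arg z"
proof -
  have "Im w / Re w < Im z / Re z" using assms by (simp add: divide_simps algebra_simps)
  then show ?thesis using arg_conv_arctan assms(1,2) by (simp add: arctan_less_iff)
qed

subsection \<open>Stability\<close>

context sp_rep
begin

lemma dim_space_pos:
  assumes "x \<in> verts n" "spc M x \<noteq> {0}"
  shows "dim (spc M x) > 0"
proof -
  obtain B where "finite B" "span B = spc M x" using sp_objectD(1) assms(1) by auto
  then show ?thesis using dim_pos[OF space_subspace[OF assms(1)]] assms(2) by blast
qed

lemma Re_charge_pos:
  assumes "\<not> zero_rep (verts n) M"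
  shows "Re (polygon_charge n p (dimvec scale (verts n) M)) > 0"
proof -
  obtain y where "y \<in> verts n" "spc M y \<noteq> {0}" using assms unfolding zero_rep_def by blast
  then show ?thesis
    using dim_space_pos by (intro Re_polygon_charge_pos[of _ y]) (simp_all add: dimvec_def)
qed

lemma indecomposable_stable:
  assumes ind: "indecomposable scale (verts n) (alien_le n Q F) M"
  shows "phi_stable scale (verts n) (alien_le n Q F) (polygon_charge n p) M"
proof -
  let ?Z = "polygon_charge n p"
  obtain a b v where ab: "1 \<le> a" "a \<le> b" "b \<le> n + 2"
    and v: "\<And>x. x \<in> {a..b} \<Longrightarrow> v x \<noteq> 0 \<and> spc M x = span {v x}"
    and out: "\<And>x. x \<in> verts n - {a..b} \<Longrightarrow> spc M x = {0}"
    and arr: "\<And>x y. x \<in> {a..b} \<Longrightarrow> y \<in> {a..b} \<Longrightarrow> (x, y) \<in> Q \<Longrightarrow> str M y x (v x) = v y"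
    by (rule indecomposable_thin_interval[OF ind]) (rule that; assumption)
  have sub: "{a..b} \<subseteq> verts n" using ab by (auto simp: verts_def)
  have "dimvec scale (verts n) M = (\<lambda>x. if x \<in> {a..b} then 1 else 0)"
  proof
    fix x show "dimvec scale (verts n) M x = (if x \<in> {a..b} then 1 else 0)"
      using v[of x] out[of x] sub dim_span_singleton dim_zero_space by (auto simp: dimvec_def)
  qed
  then have ZM: "?Z (dimvec scale (verts n) M) = p b - p (a - 1)"
    using polygon_charge_interval[of "a - 1" b n p] ab by (simp add: seg_vec_def)
  have nz: "\<not> zero_rep (verts n) M" using ind unfolding indecomposable_def by blast
  have "stability_fun scale (verts n) ?Z L < stability_fun scale (verts n) ?Z M"
    if L: "subrep scale (verts n) (alien_le n Q F) L M" "\<not> zero_rep (verts n) L"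
      "\<exists>x\<in>verts n. spc L x \<noteq> spc M x" for L
  proof -
    have Ls: "subspace (spc L x)" "spc L x \<subseteq> spc M x" if "x \<in> verts n" for x
      using L(1) that unfolding subrep_def by auto
    have Lstr: "str M y x ` spc L x \<subseteq> spc L y" if "alien_le n Q F x y" for x y
      using L(1) that le_verts[OF that] unfolding subrep_def by auto
    define S where "S = {x \<in> {a..b}. spc L x \<noteq> {0}}"
    \<comment> \<open>The space of \<open>M\<close> at \<open>x\<close> is a line, so a nonzero
      subspace is all of it: \<open>L\<close> is determined by its support \<open>S\<close>.\<close>
    have LS: "v x \<in> spc L x" "spc L x = span {v x}" if "x \<in> S" for x
    proof -
      have x: "x \<in> {a..b}" "x \<in> verts n" "spc L x \<noteq> {0}" using that sub unfolding S_def by auto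
      obtain u where u: "u \<in> spc L x" "u \<noteq> 0" using x(3) subspace_0[OF Ls(1)[OF x(2)]] by blast
      then obtain c where c: "u = scale c (v x)"
        using Ls(2)[OF x(2)] v[OF x(1)] by (auto simp: span_singleton)
      then have "v x = scale (inverse c) u" using u(2) by auto
      then show vL: "v x \<in> spc L x" using subspace_scale[OF Ls(1)[OF x(2)] u(1)] by simp
      show "spc L x = span {v x}"
        using Ls[OF x(2)] v[OF x(1)] vL span_minimal[of "{v x}" "spc L x"] by auto
    qed
    have L0: "spc L x = {0}" if "x \<in> verts n" "x \<notin> S" for x
    proof (cases "x \<in> {a..b}")
      case False
      then show ?thesis using out[of x] that Ls[OF that(1)] subspace_0 by fastforce
    qed (use that in \<open>simp add: S_def\<close>)
    have Sab: "S \<subseteq> {a..b}" by (auto simp: S_def)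
    have "dimvec scale (verts n) L = (\<lambda>x. if x \<in> S then 1 else 0)"
    proof
      fix x show "dimvec scale (verts n) L x = (if x \<in> S then 1 else 0)"
        using LS[of x] L0[of x] v[of x] Sab sub dim_span_singleton[of "v x"] dim_zero_space
        by (auto simp: dimvec_def)
    qed
    then have ZL: "?Z (dimvec scale (verts n) L) = (\<Sum>x\<in>S. p x - p (x - 1))"
      using Sab sub polygon_charge_indicator[of S n p] by auto
    have ReL: "Re (?Z (dimvec scale (verts n) L)) > 0"
    proof -
      obtain y where y: "y \<in> verts n" "spc L y \<noteq> {0}" using L(2) unfolding zero_rep_def by blast
      then have "y \<in> S" using L0 by blast
      then show ?thesis unfolding \<open>dimvec scale (verts n) L = _\<close>
        using y(1) by (intro Re_polygon_charge_pos[of _ y]) auto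
    qed
    have "S \<noteq> {}" using L(2) L0 unfolding zero_rep_def by blast
    moreover have "S \<noteq> {a..b}"
    proof
      assume eq: "S = {a..b}"
      obtain x where x: "x \<in> verts n" "spc L x \<noteq> spc M x" using L(3) by blast
      show False
        using x LS(2)[of x] L0[of x] v[of x] out[of x] eq by (cases "x \<in> {a..b}") auto
    qed
    \<comment> \<open>The normalised maps send the generator at \<open>x\<close> to the nonzero
      generator at \<open>y\<close>, so the support of \<open>L\<close> is closed under arrows of
      \<open>Q\<close>.\<close>
    moreover have "y \<in> S" if xy: "x \<in> S" "y \<in> {a..b}" "(x, y) \<in> Q" for x y
    proof -
      have "v y = str M y x (v x)" using arr[of x y] xy Sab by auto
      then have "v y \<in> spc L y" using Lstr[OF arrow_le[of x y]] LS(1)[OF xy(1)] xy(3) by auto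
      then show ?thesis using v[OF xy(2)] xy(2) by (auto simp: S_def)
    qed
    ultimately have neg: "(\<Sum>x\<in>S. cross p (a - 1) b x - cross p (a - 1) b (x - 1)) < 0"
      by (intro cross_closed_subset_neg ab Sab) auto
    \<comment> \<open>\<open>cross\<close> is affine in its last point, so its increments add up to
      the cross product of the chord with the charge of \<open>L\<close>.\<close>
    have "(\<Sum>x\<in>S. cross p (a - 1) b x - cross p (a - 1) b (x - 1))
        = Im (cnj (p b - p (a - 1)) * (\<Sum>x\<in>S. p x - p (x - 1)))"
      unfolding sum_distrib_left Im_sum cross_def by (rule sum.cong) (auto simp: algebra_simps)
    then have "Im (cnj (?Z (dimvec scale (verts n) M)) * ?Z (dimvec scale (verts n) L)) < 0"
      using neg unfolding ZM ZL by simp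
    then have "Arg (?Z (dimvec scale (verts n) L)) < Arg (?Z (dimvec scale (verts n) M))"
      using ReL Re_charge_pos[OF nz] by (intro Arg_less_of_cross_neg) auto
    then show ?thesis unfolding stability_fun_def by (simp add: divide_strict_right_mono)
  qed
  then show ?thesis using M nz unfolding phi_stable_def by blast
qed

end

lemma dim_field_UNIV: "vector_space.dim ((*) :: 'k::field \<Rightarrow> 'k \<Rightarrow> 'k) UNIV = 1"
  using vector_space.dim_span_singleton[OF vector_space_over_itself.vector_space_axioms, of "1::'k"]
  by (simp add: vector_space_over_itself.span_singleton)

lemma dimvec_seg_rep:
  assumes "m \<le> n + 2"
  shows "dimvec ((*) :: 'k::field \<Rightarrow> 'k \<Rightarrow> 'k) (verts n) (seg_rep le (s, m))
    = (\<lambda>x. if x \<in> {s + 1..m} then 1 else 0)"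
proof
  fix x
  have spc: "spc (seg_rep le (s, m) :: (nat, 'k) poset_rep) x = (if x \<in> {s + 1..m} then UNIV else {0})"
    unfolding seg_rep_def Let_def by simp
  show "dimvec ((*) :: 'k \<Rightarrow> 'k \<Rightarrow> 'k) (verts n) (seg_rep le (s, m)) x = (if x \<in> {s + 1..m} then 1 else 0)"
  proof (cases "x \<in> {s + 1..m}")
    case True
    then have "x \<in> verts n" using assms by (simp add: verts_def)
    then show ?thesis unfolding dimvec_def spc using True dim_field_UNIV[where 'k = 'k] by simp
  next
    case False
    then show ?thesis unfolding dimvec_def spc if_not_P[OF False]
      using vector_space.dim_zero_space[OF vector_space_over_itself.vector_space_axioms[where 'a = 'k]]
      by simp
  qed
qed

context sp_rep
begin

text \<open>The two objects live in different ambient spaces, so dimensions are compared directly: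
  over the interval the preimage of \<open>1\<close> spans the space, elsewhere injectivity makes it
  zero.\<close>

lemma dimvec_rep_iso_seg_rep:
  assumes iso: "rep_iso scale ((*) :: 'k \<Rightarrow> 'k \<Rightarrow> 'k) (verts n) (alien_le n Q F) M (seg_rep (alien_le n Q F) (s, m))"
    and m: "m \<le> n + 2"
  shows "dimvec scale (verts n) M = (\<lambda>x. if x \<in> {s + 1..m} then 1 else 0)"
proof
  fix x
  let ?N = "seg_rep (alien_le n Q F) (s, m) :: (nat, 'k) poset_rep"
  show "dimvec scale (verts n) M x = (if x \<in> {s + 1..m} then 1 else 0)"
  proof (cases "x \<in> verts n")
    case False
    then show ?thesis using m by (auto simp: dimvec_def verts_def)
  next
    case x: True
    obtain f where lin: "linear_between scale ((*) :: 'k \<Rightarrow> 'k \<Rightarrow> 'k) (spc M x) (spc ?N x) f"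
      and bij: "bij_betw f (spc M x) (spc ?N x)"
      using iso x unfolding rep_iso_def by blast
    have Ms: "subspace (spc M x)" using space_subspace[OF x] .
    have inj: "inj_on f (spc M x)" and surj: "f ` spc M x = spc ?N x"
      using bij by (auto simp: bij_betw_def)
    show ?thesis
    proof (cases "x \<in> {s + 1..m}")
      case True
      then have "spc ?N x = UNIV" by (simp add: seg_rep_def Let_def)
      then obtain u where u: "u \<in> spc M x" "f u = 1" using surj by (metis UNIV_I image_iff)
      have sc: "f (scale c u) = c" for c
        using lin u unfolding linear_between_def by simp
      have "spc M x = span {u}"
      proof
        show "spc M x \<subseteq> span {u}"
        proof
          fix w assume w: "w \<in> spc M x"
          have "f (scale (f w) u) = f w" using sc .
          then have "w = scale (f w) u"
            using inj w subspace_scale[OF Ms u(1)] by (metis inj_onD)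
          then show "w \<in> span {u}" by (metis span_base span_scale singletonI)
        qed
        show "span {u} \<subseteq> spc M x" using u(1) Ms by (intro span_minimal) auto
      qed
      moreover have "u \<noteq> 0" using sc[of 0] sc[of 1] by auto
      ultimately show ?thesis using dim_span_singleton x True by (simp add: dimvec_def)
    next
      case False
      then have "spc ?N x = {0}" by (auto simp: seg_rep_def Let_def)
      then have "f w = f 0" if "w \<in> spc M x" for w
        using surj that subspace_0[OF Ms] by (metis imageI singletonD)
      then have "spc M x = {0}" using inj subspace_0[OF Ms] by (auto dest: inj_onD)
      then show ?thesis using dim_zero_space x False by (simp add: dimvec_def)
    qed
  qed
qed

end

text \<open>That the assignment induces \<open>Z\<close> is expressed by existence together with
  uniqueness on \<open>K0\<close>, outside of which a competing \<open>Z'\<close> is unconstrained.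
  Interval representations are built over the field itself, so the angle is also stated for
  isomorphic objects in the ambient space of \<open>scale\<close>.\<close>

theorem theorem4p3:
  fixes n :: nat
    and Q F :: "arrow set"
    and p :: "nat \<Rightarrow> complex"
    and scale :: "'k::field \<Rightarrow> 'v::ab_group_add \<Rightarrow> 'v"
  assumes "type_A_quiver n Q"
    and "alien_set n Q F"
    and "polygon n Q p"
    and "vector_space scale"
  shows "\<exists>Z.
      K0_hom (verts n) Z \<and>
      (\<forall>g\<in>sp_segments n Q F p.
         Z (dimvec ((*) :: 'k \<Rightarrow> 'k \<Rightarrow> 'k) (verts n) (seg_rep (alien_le n Q F) g)) = seg_vec p g) \<and>
      (\<forall>Z'. K0_hom (verts n) Z' \<longrightarrow>
         (\<forall>g\<in>sp_segments n Q F p.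
            Z' (dimvec ((*) :: 'k \<Rightarrow> 'k \<Rightarrow> 'k) (verts n) (seg_rep (alien_le n Q F) g)) = seg_vec p g) \<longrightarrow>
         (\<forall>d\<in>K0 (verts n). Z' d = Z d)) \<and>
      central_charge scale (verts n) (alien_le n Q F) Z \<and>
      (\<forall>g\<in>sp_segments n Q F p. \<exists>\<theta>. - pi / 2 < \<theta> \<and> \<theta> < pi / 2 \<and>
         seg_vec p g = complex_of_real (cmod (seg_vec p g)) * cis \<theta> \<and>
         stability_fun ((*) :: 'k \<Rightarrow> 'k \<Rightarrow> 'k) (verts n) Z (seg_rep (alien_le n Q F) g) = \<theta> / pi \<and>
         (\<forall>M. sp_object scale (verts n) (alien_le n Q F) M \<longrightarrow>
              rep_iso scale ((*) :: 'k \<Rightarrow> 'k \<Rightarrow> 'k) (verts n) (alien_le n Q F)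
                M (seg_rep (alien_le n Q F) g) \<longrightarrow>
              stability_fun scale (verts n) Z M = \<theta> / pi)) \<and>
      (\<forall>M. indecomposable scale (verts n) (alien_le n Q F) M \<longrightarrow>
           phi_stable scale (verts n) (alien_le n Q F) Z M)"
proof -
  interpret alien_polygon n Q p F
    by (intro alien_polygon.intro type_A_polygon.intro alien_polygon_axioms.intro assms)
  have sp_repI: "sp_rep n Q F p scale M" if "sp_object scale (verts n) (alien_le n Q F) M" for M
    by (intro sp_rep.intro sp_rep_axioms.intro alien_polygon_axioms assms(4) that)
  let ?Z = "polygon_charge n p"
  let ?dim = "\<lambda>g. dimvec ((*) :: 'k \<Rightarrow> 'k \<Rightarrow> 'k) (verts n) (seg_rep (alien_le n Q F) g)"
  have dimg: "?dim (s, m) = (\<lambda>x. if x \<in> {s + 1..m} then 1 else 0)"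
    if "(s, m) \<in> sp_segments n Q F p" for s m
    using sp_segment_bounds[OF that] by (intro dimvec_seg_rep) simp
  have charge: "?Z (?dim (s, m)) = seg_vec p (s, m)" if "(s, m) \<in> sp_segments n Q F p" for s m
    using polygon_charge_interval sp_segment_bounds[OF that] unfolding dimg[OF that] by blast
  have unique: "Z' d = ?Z d"
    if Z': "K0_hom (verts n) Z'" "\<And>g. g \<in> sp_segments n Q F p \<Longrightarrow> Z' (?dim g) = seg_vec p g"
      and d: "d \<in> K0 (verts n)" for Z' d
  proof -
    \<comment> \<open>The difference of two candidates is a homomorphism that vanishes on the
      indicator of every up-set, since that is the dimension vector of a line sp-segment.\<close>
    have "Z' d - ?Z d = 0"
    proof (rule K0_hom_vanishes[where D = "\<lambda>d. Z' d - ?Z d" and r = "Q \<union> F" and P = "verts n"])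
      show "K0_hom (verts n) (\<lambda>d. Z' d - ?Z d)"
        using Z'(1) polygon_charge_hom[of n p] unfolding K0_hom_def by simp
      show "Z' (\<lambda>y. if (x, y) \<in> (Q \<union> F)\<^sup>* then 1 else 0) - ?Z (\<lambda>y. if (x, y) \<in> (Q \<union> F)\<^sup>* then 1 else 0) = 0"
        if x: "x \<in> verts n" for x
      proof -
        obtain l r where lr: "{y. (x, y) \<in> (Q \<union> F)\<^sup>*} = {l..r}" "1 \<le> l"
          and g: "(l - 1, r) \<in> sp_segments n Q F p"
          using upset_segment[OF x] by metis
        have "?dim (l - 1, r) = (\<lambda>y. if y \<in> {l..r} then 1 else 0)"
          unfolding dimg[OF g] using lr(2) by simp
        then have "?dim (l - 1, r) = (\<lambda>y. if (x, y) \<in> (Q \<union> F)\<^sup>* then 1 else 0)"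
          unfolding lr(1)[symmetric] mem_Collect_eq .
        then show ?thesis using Z'(2)[OF g] charge[OF g] by simp
      qed
      show "y \<in> verts n" if "x \<in> verts n" "(x, y) \<in> (Q \<union> F)\<^sup>*" for x y
        using reach_verts[OF that(2,1)] .
    qed (use wf_arrows d in \<open>auto simp: verts_def\<close>)
    then show ?thesis by simp
  qed
  have central: "central_charge scale (verts n) (alien_le n Q F) ?Z"
    unfolding central_charge_def
    using polygon_charge_hom sp_rep.Re_charge_pos[OF sp_repI] Re_pos_right_half_plane by blast
  have angle: "\<exists>\<theta>. - pi / 2 < \<theta> \<and> \<theta> < pi / 2 \<and>
         seg_vec p g = complex_of_real (cmod (seg_vec p g)) * cis \<theta> \<and>
         stability_fun ((*) :: 'k \<Rightarrow> 'k \<Rightarrow> 'k) (verts n) ?Z (seg_rep (alien_le n Q F) g) = \<theta> / pi \<and>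
         (\<forall>M. sp_object scale (verts n) (alien_le n Q F) M \<longrightarrow>
              rep_iso scale ((*) :: 'k \<Rightarrow> 'k \<Rightarrow> 'k) (verts n) (alien_le n Q F)
                M (seg_rep (alien_le n Q F) g) \<longrightarrow>
              stability_fun scale (verts n) ?Z M = \<theta> / pi)"
    if g: "g \<in> sp_segments n Q F p" for g
  proof -
    obtain s m where sm: "g = (s, m)" by fastforce
    note gsm = g[unfolded sm]
    have "Re (seg_vec p g) > 0"
      using Re_less sp_segment_bounds[OF gsm] by (simp add: sm seg_vec_def)
    then have "- pi / 2 < Arg (seg_vec p g) \<and> Arg (seg_vec p g) < pi / 2"
      by (rule Arg_right_half_plane)
    moreover have "seg_vec p g = complex_of_real (cmod (seg_vec p g)) * cis (Arg (seg_vec p g))"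
      using rcis_cmod_Arg[of "seg_vec p g"] by (simp add: rcis_def)
    moreover have "stability_fun ((*) :: 'k \<Rightarrow> 'k \<Rightarrow> 'k) (verts n) ?Z (seg_rep (alien_le n Q F) g) = Arg (seg_vec p g) / pi"
      unfolding stability_fun_def sm charge[OF gsm] ..
    moreover have "stability_fun scale (verts n) ?Z M = Arg (seg_vec p g) / pi"
      if "sp_object scale (verts n) (alien_le n Q F) M"
        "rep_iso scale ((*) :: 'k \<Rightarrow> 'k \<Rightarrow> 'k) (verts n) (alien_le n Q F) M (seg_rep (alien_le n Q F) g)" for M
    proof -
      have "dimvec scale (verts n) M = ?dim (s, m)"
        using sp_rep.dimvec_rep_iso_seg_rep[OF sp_repI[OF that(1)] that(2)[unfolded sm]]
          sp_segment_bounds[OF gsm] dimg[OF gsm] by simp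
      then show ?thesis unfolding stability_fun_def sm using charge[OF gsm] by simp
    qed
    ultimately show ?thesis by blast
  qed
  have stable: "phi_stable scale (verts n) (alien_le n Q F) ?Z M"
    if ind: "indecomposable scale (verts n) (alien_le n Q F) M" for M
  proof -
    have "sp_object scale (verts n) (alien_le n Q F) M" using ind by (simp add: indecomposable_def)
    then show ?thesis using sp_rep.indecomposable_stable[OF sp_repI ind] by blast
  qed
  show ?thesis
  proof (intro exI[of _ ?Z] conjI ballI allI impI)
    show "?Z (?dim g) = seg_vec p g" if "g \<in> sp_segments n Q F p" for g
      using charge that by (cases g) simp
  qed (use polygon_charge_hom unique central angle stable in blast)+
qed

end
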